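(* Let $(Z_n)_{n\ge0}$ be a Galton--Watson process with $Z_0=1$ and offspring distribution $F$ on $\{0,1,2,\dots\}$ with mean $m:=\mathbb E\xi>1$, and let $W_n:=Z_n/m^n$ and $W:=\lim_{n\to\infty}W_n$ (almost sure limit). Assume $F$ is dominated varying, i.e. $\sup_x \overline F(x/2)/\overline F(x)<\infty$, and that for some $\delta>0$ and $c<\infty$, $$\overline F(xy)\le c\,\overline F(x)/y^{1+\delta}\quad\text{for all } x,y>1.$$ If $\mathbb E\xi^2<\infty$ and $F$ is $x^\gamma$-insensitive for some $\gamma>1/2$, then, uniformly in $n\ge1$, $$\Pr\{W_n>x\}\sim\sum_{i=0}^{n-1}m^i\overline F(m^{i+1}x)\quad\text{as }x\to\infty,$$ $$\Pr\{W_n>x\}\sim\sum_{i=0}^{\infty}m^i\overline F(m^{i+1}x)\quad\text{as }x,n\to\infty,$$ and $$\Pr\{W>x\}\sim\sum_{i=0}^{\infty}m^i\overline F(m^{i+1}x)\quad\text{as }x\to\infty.$$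
   Context: The process is defined by $Z_{n+1}=\sum_{i=1}^{Z_n}\xi_i^{(n)}$, where $\xi_i^{(n)}$, $i\ge1$, $n\ge0$, are i.i.d. copies of a random variable $\xi$ with distribution $F$ on $\{0,1,2,\dots\}$; $\overline F(x):=\Pr\{\xi>x\}$ for real $x$. $f(x)\sim g(x)$ means $f(x)/g(x)\to1$. For a positive function $h(x)\to\infty$, $F$ is $h$-insensitive if $\overline F(x+h(x))\sim\overline F(x)$ as $x\to\infty$; "$x^\gamma$-insensitive" means $h(x)=x^\gamma$. *)

theory Defs
  imports "HOL-Probability.Probability" "HOL-Library.Landau_Symbols"
begin

fun GW_Z :: "(nat \<Rightarrow> nat \<Rightarrow> 'a \<Rightarrow> nat) \<Rightarrow> nat \<Rightarrow> 'a \<Rightarrow> nat" where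
  "GW_Z xi 0 \<omega> = 1"
| "GW_Z xi (Suc n) \<omega> = (\<Sum>i\<in>{1..GW_Z xi n \<omega>}. xi n i \<omega>)"

definition tail :: "nat pmf \<Rightarrow> real \<Rightarrow> real" where
  "tail F x = measure_pmf.prob F {k. real k > x}"

definition pmf_mean :: "nat pmf \<Rightarrow> real" where
  "pmf_mean F = measure_pmf.expectation F real"

definition GW_W :: "(nat \<Rightarrow> nat \<Rightarrow> 'a \<Rightarrow> nat) \<Rightarrow> real \<Rightarrow> nat \<Rightarrow> 'a \<Rightarrow> real" where
  "GW_W xi m n \<omega> = real (GW_Z xi n \<omega>) / m ^ n"

definition GW_Wlim :: "(nat \<Rightarrow> nat \<Rightarrow> 'a \<Rightarrow> nat) \<Rightarrow> real \<Rightarrow> 'a \<Rightarrow> real" where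
  "GW_Wlim xi m \<omega> = lim (\<lambda>n. GW_W xi m n \<omega>)"

end

theory Submission
  imports Defs "HOL-Real_Asymp.Real_Asymp"
begin

text \<open>
  \<open>W\<^sub>n > x\<close> happens essentially only because in one generation \<open>i\<close> a single individual has more than
  about \<open>y = m ^ (i + 1) * x\<close> children, and there are \<open>m ^ i\<close> candidates on average. A path is split at
  the first generation with a big jump.

  Lower bound: a jump above \<open>y + y powr \<gamma>\<close> suffices by Chebyshev's inequality, since
  \<open>\<gamma> > 1/2\<close> beats the fluctuations \<open>sqrt y\<close> of the later generations; an earlier big jump is unlikely,
  and by the second moment bound it carries little of the mean of \<open>Z\<^sub>i\<close>.

  Upper bound: with jumps truncated at \<open>\<eta> * y\<close> an exponential moment estimate gives
  an arbitrarily fast polynomial decay, which is negligible by dominated variation. Jumps in late generations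
  are negligible by the geometric decay of \<open>m ^ i * tail F (m ^ (i + 1) * x)\<close>. For each of the finitely many
  remaining generations, a jump between \<open>\<eta> * y\<close> and \<open>y - y powr \<gamma> / 2\<close> needs either
  unusually large siblings or a large deviation of later generations.

  For \<open>W\<close> one passes to the limit in \<open>n\<close>; the \<open>L\<^sup>1\<close> norms of the increments of \<open>W\<^sub>n\<close> are summable.
\<close>

section \<open>One generation of the process\<close>

text \<open>Almost everything is done with the transition operator on \<open>ennreal\<close>-valued
  functions of the generation size: probabilities and moments of later generations are its iterates
  on indicators and powers, and the sample space enters only at the end. Uniformity in
  \<open>n\<close> has one source: after a jump in generation \<open>i\<close> the target
  \<open>m ^ n * x\<close> equals \<open>m ^ (n - Suc i) * y\<close>, and Chebyshev's bound with the
  limiting variance \<open>V\<close> does not see how many generations remain. The estimate for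
  siblings of a jump costs \<open>m ^ i * y powr - g\<close> relative to the main term, which is not
  uniform in \<open>i\<close> since \<open>g < 1\<close>; hence the cut between early and late
  generations is fixed before \<open>x\<close> grows. The constant \<open>\<eta>\<close> is forced:
  dominated variation bounds the tail from below by a power of \<open>x\<close>, this fixes the
  decay exponent \<open>K\<close> demanded of paths without a jump, and the exponential moments
  deliver it at truncation \<open>1 / (4 * K)\<close>.\<close>

lemma nn_integral_replicate_pmf_Suc:
  "(\<integral>\<^sup>+xs. f xs \<partial>replicate_pmf (Suc z) F) = (\<integral>\<^sup>+k. \<integral>\<^sup>+xs. f (k # xs) \<partial>replicate_pmf z F \<partial>F)"
  by simp

lemma nn_integral_indicator_gt:
  "(\<integral>\<^sup>+k. indicator {k. a < real k} k \<partial>measure_pmf F) = ennreal (tail F a)"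
  by (simp add: tail_def measure_pmf.emeasure_eq_measure)

text \<open>Transition operator of the Markov chain of generation sizes: the conditional expectation
  of \<open>f\<close> at the next size, given the present size \<open>z\<close>. Values in
  \<open>ennreal\<close> avoid integrability conditions.\<close>

definition gw_step :: "nat pmf \<Rightarrow> (nat \<Rightarrow> ennreal) \<Rightarrow> nat \<Rightarrow> ennreal" where
  "gw_step F f z = (\<integral>\<^sup>+xs. f (sum_list xs) \<partial>replicate_pmf z F)"

definition gw_step_le :: "nat pmf \<Rightarrow> real \<Rightarrow> (nat \<Rightarrow> ennreal) \<Rightarrow> nat \<Rightarrow> ennreal" where
  "gw_step_le F a f z =
    (\<integral>\<^sup>+xs. f (sum_list xs) * indicator {xs. \<forall>k\<in>set xs. real k \<le> a} xs \<partial>replicate_pmf z F)"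

definition gw_step_gt :: "nat pmf \<Rightarrow> real \<Rightarrow> (nat \<Rightarrow> ennreal) \<Rightarrow> nat \<Rightarrow> ennreal" where
  "gw_step_gt F a f z =
    (\<integral>\<^sup>+xs. f (sum_list xs) * indicator {xs. \<exists>k\<in>set xs. a < real k} xs \<partial>replicate_pmf z F)"

text \<open>The recursion peels off the last generation, so \<open>a i\<close> limits the offspring
  numbers of the step from generation \<open>i\<close> to \<open>i + 1\<close>, and the final
  argument is the initial size.\<close>

fun gw_path_le :: "nat pmf \<Rightarrow> (nat \<Rightarrow> real) \<Rightarrow> nat \<Rightarrow> (nat \<Rightarrow> ennreal) \<Rightarrow> nat \<Rightarrow> ennreal" where
  "gw_path_le F a 0 f = f"
| "gw_path_le F a (Suc n) f = gw_path_le F a n (gw_step_le F (a n) f)"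

lemma gw_step_split: "gw_step F f z = gw_step_le F a f z + gw_step_gt F a f z"
proof -
  have "f (sum_list xs) = f (sum_list xs) * indicator {xs. \<forall>k\<in>set xs. real k \<le> a} xs
      + f (sum_list xs) * indicator {xs. \<exists>k\<in>set xs. a < real k} xs" for xs
    by (cases "\<forall>k\<in>set xs. real k \<le> a") (auto simp: indicator_def not_less not_le)
  then show ?thesis
    unfolding gw_step_def gw_step_le_def gw_step_gt_def
    by (subst nn_integral_add [symmetric]) auto
qed

lemma gw_step_mono: "(\<And>z. f z \<le> g z) \<Longrightarrow> gw_step F f z \<le> gw_step F g z"
  unfolding gw_step_def by (intro nn_integral_mono) auto

lemma gw_step_le_mono: "(\<And>z. f z \<le> g z) \<Longrightarrow> gw_step_le F a f z \<le> gw_step_le F a g z"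
  unfolding gw_step_le_def by (intro nn_integral_mono mult_right_mono) auto

lemma gw_step_gt_mono: "(\<And>z. f z \<le> g z) \<Longrightarrow> gw_step_gt F a f z \<le> gw_step_gt F a g z"
  unfolding gw_step_gt_def by (intro nn_integral_mono mult_right_mono) auto

lemma gw_step_linear:
  "gw_step F (\<lambda>z. p * f z + q * g z) z = p * gw_step F f z + q * gw_step F g z"
  unfolding gw_step_def by (simp add: nn_integral_add nn_integral_cmult)

lemma gw_step_le_linear:
  "gw_step_le F a (\<lambda>z. p * f z + q * g z) z = p * gw_step_le F a f z + q * gw_step_le F a g z"
  unfolding gw_step_le_def
  by (simp add: nn_integral_add nn_integral_cmult distrib_right mult.assoc)

lemma gw_step_gt_linear:
  "gw_step_gt F a (\<lambda>z. p * f z + q * g z) z = p * gw_step_gt F a f z + q * gw_step_gt F a g z"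
  unfolding gw_step_gt_def
  by (simp add: nn_integral_add nn_integral_cmult distrib_right mult.assoc)

lemma gw_iter_mono: "(\<And>z. f z \<le> g z) \<Longrightarrow> (gw_step F ^^ n) f z \<le> (gw_step F ^^ n) g z"
  by (induction n arbitrary: z) (auto intro: gw_step_mono)

lemma gw_iter_linear:
  "(gw_step F ^^ n) (\<lambda>z. p * f z + q * g z) z
    = p * (gw_step F ^^ n) f z + q * (gw_step F ^^ n) g z"
proof (induction n arbitrary: z)
  case (Suc n)
  then have "(gw_step F ^^ n) (\<lambda>z. p * f z + q * g z)
    = (\<lambda>z. p * (gw_step F ^^ n) f z + q * (gw_step F ^^ n) g z)" by auto
  then show ?case by (simp add: gw_step_linear)
qed simp

lemma gw_path_le_mono: "(\<And>z. f z \<le> g z) \<Longrightarrow> gw_path_le F a n f z \<le> gw_path_le F a n g z"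
proof (induction n arbitrary: f g)
  case (Suc n)
  then show ?case by (simp add: gw_step_le_mono)
qed simp

lemma gw_path_le_linear:
  "gw_path_le F a n (\<lambda>z. p * f z + q * g z) z
    = p * gw_path_le F a n f z + q * gw_path_le F a n g z"
proof (induction n arbitrary: f g)
  case (Suc n)
  have "gw_step_le F (a n) (\<lambda>z. p * f z + q * g z)
    = (\<lambda>z. p * gw_step_le F (a n) f z + q * gw_step_le F (a n) g z)"
    by (rule ext) (rule gw_step_le_linear)
  then show ?case by (simp add: Suc)
qed simp

lemmas gw_iter_add = gw_iter_linear [where p = 1 and q = 1, simplified]
lemmas gw_iter_cmult = gw_iter_linear [where q = 0, simplified]
lemmas gw_step_cmult = gw_step_linear [where q = 0, simplified]
lemmas gw_step_gt_cmult = gw_step_gt_linear [where q = 0, simplified]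
lemmas gw_path_le_add = gw_path_le_linear [where p = 1 and q = 1, simplified]
lemmas gw_path_le_cmult = gw_path_le_linear [where q = 0, simplified]

lemma funpow_Suc_apply: "(h ^^ Suc n) f = (h ^^ n) (h f)"
  by (simp add: funpow_Suc_right del: funpow.simps)

lemma gw_path_le_le_iter: "gw_path_le F a n f z \<le> (gw_step F ^^ n) f z"
proof (induction n arbitrary: f)
  case (Suc n)
  have "gw_path_le F a (Suc n) f z \<le> gw_path_le F a n (gw_step F f) z"
    by (simp, intro gw_path_le_mono) (simp add: gw_step_split [of F f _ "a n"])
  also have "\<dots> \<le> (gw_step F ^^ Suc n) f z"
    unfolding funpow_Suc_apply by (rule Suc)
  finally show ?case .
qed simp

text \<open>Decomposition according to the first generation \<open>i\<close> in which some individual has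
  more than \<open>a i\<close> children.\<close>

lemma gw_iter_decomp:
  "(gw_step F ^^ n) f z = gw_path_le F a n f z
    + (\<Sum>i<n. gw_path_le F a i (gw_step_gt F (a i) ((gw_step F ^^ (n - Suc i)) f)) z)"
proof (induction n arbitrary: f)
  case (Suc n)
  have *: "(gw_step F ^^ (n - Suc i)) (gw_step F f) = (gw_step F ^^ (Suc n - Suc i)) f" if "i < n" for i
    using that by (simp add: funpow_Suc_apply [symmetric] Suc_diff_Suc del: funpow.simps)
  have split: "gw_step F f = (\<lambda>z. gw_step_le F (a n) f z + gw_step_gt F (a n) f z)"
    by (rule ext) (rule gw_step_split)
  have "(gw_step F ^^ Suc n) f z = gw_path_le F a n (gw_step F f) z
    + (\<Sum>i<n. gw_path_le F a i (gw_step_gt F (a i) ((gw_step F ^^ (n - Suc i)) (gw_step F f))) z)"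
    unfolding funpow_Suc_apply by (rule Suc)
  also have "(\<Sum>i<n. gw_path_le F a i (gw_step_gt F (a i) ((gw_step F ^^ (n - Suc i)) (gw_step F f))) z)
     = (\<Sum>i<n. gw_path_le F a i (gw_step_gt F (a i) ((gw_step F ^^ (Suc n - Suc i)) f)) z)"
    by (intro sum.cong refl) (simp only: * lessThan_iff)
  also have "gw_path_le F a n (gw_step F f) z
     = gw_path_le F a (Suc n) f z + gw_path_le F a n (gw_step_gt F (a n) f) z"
    by (subst split) (simp add: gw_path_le_add)
  finally show ?case by (simp add: ac_simps)
qed simp

lemma gw_step_one: "gw_step F (\<lambda>_. 1) z = 1"
  unfolding gw_step_def by (simp add: measure_pmf.emeasure_space_1 [simplified])

lemma gw_iter_one: "(gw_step F ^^ n) (\<lambda>_. 1) = (\<lambda>_. 1)"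
  by (induction n) (auto simp: gw_step_one)

lemma gw_iter_le_one: "(\<And>z. f z \<le> 1) \<Longrightarrow> (gw_step F ^^ n) f z \<le> 1"
  using gw_iter_mono [where f = f and g = "\<lambda>_. 1" and F = F and n = n and z = z] by (simp add: gw_iter_one)

section \<open>Offspring numbers exceeding a level\<close>

lemma tail_nonneg [simp]: "0 \<le> tail F x"
  by (simp add: tail_def)

lemma tail_antimono: "x \<le> y \<Longrightarrow> tail F y \<le> tail F x"
  unfolding tail_def by (intro measure_pmf.finite_measure_mono) auto

lemma gw_step_gt_one_0: "gw_step_gt F a (\<lambda>_. 1) 0 = 0"
  by (simp add: gw_step_gt_def)

lemma gw_step_gt_one_Suc_gen:
  "gw_step_gt F a (\<lambda>_. 1) (Suc z)
    = (\<integral>\<^sup>+k. (if a < real k then 1 else gw_step_gt F a (\<lambda>_. 1) z) \<partial>F)"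
proof -
  have *: "indicator {xs. \<exists>k\<in>set xs. a < real k} (k # xs)
     = (if a < real k then 1 else indicator {xs. \<exists>k\<in>set xs. a < real k} xs :: ennreal)" for k xs
    by (auto simp: indicator_def)
  show ?thesis
    unfolding gw_step_gt_def nn_integral_replicate_pmf_Suc
    by (intro nn_integral_cong) (simp add: * measure_pmf.emeasure_space_1 [simplified])
qed

lemma gw_step_gt_one_Suc_le:
  "gw_step_gt F a (\<lambda>_. 1) (Suc z) \<le> ennreal (tail F a) + gw_step_gt F a (\<lambda>_. 1) z"
proof -
  let ?G = "gw_step_gt F a (\<lambda>_. 1) z"
  have "gw_step_gt F a (\<lambda>_. 1) (Suc z) \<le> (\<integral>\<^sup>+k. indicator {k. a < real k} k + ?G \<partial>F)"
    unfolding gw_step_gt_one_Suc_gen by (intro nn_integral_mono) (auto simp: indicator_def)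
  also have "\<dots> = ennreal (tail F a) + ?G"
    by (subst nn_integral_add) (auto simp: nn_integral_indicator_gt measure_pmf.emeasure_space_1 [simplified] tail_def measure_pmf.emeasure_eq_measure)
  finally show ?thesis .
qed

text \<open>Inclusion-exclusion for one individual and \<open>z\<close> others; the product stands
  on the right because subtraction in \<open>ennreal\<close> truncates.\<close>

lemma gw_step_gt_one_Suc_ge:
  "ennreal (tail F a) + gw_step_gt F a (\<lambda>_. 1) z
    \<le> gw_step_gt F a (\<lambda>_. 1) (Suc z) + ennreal (tail F a) * gw_step_gt F a (\<lambda>_. 1) z"
proof -
  let ?G = "gw_step_gt F a (\<lambda>_. 1) z"
  have "ennreal (tail F a) + ?G = (\<integral>\<^sup>+k. indicator {k. a < real k} k + ?G \<partial>F)"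
    by (subst nn_integral_add) (auto simp: nn_integral_indicator_gt measure_pmf.emeasure_space_1 [simplified] tail_def measure_pmf.emeasure_eq_measure)
  also have "\<dots> \<le> (\<integral>\<^sup>+k. (if a < real k then 1 else ?G) + indicator {k. a < real k} k * ?G \<partial>F)"
    by (intro nn_integral_mono) (auto simp: indicator_def)
  also have "\<dots> = gw_step_gt F a (\<lambda>_. 1) (Suc z) + ennreal (tail F a) * ?G"
    unfolding gw_step_gt_one_Suc_gen
    by (subst nn_integral_add) (auto simp: nn_integral_multc nn_integral_indicator_gt tail_def measure_pmf.emeasure_eq_measure)
  finally show ?thesis .
qed

lemma gw_step_gt_one_le: "gw_step_gt F a (\<lambda>_. 1) z \<le> ennreal (tail F a) * of_nat z"
proof (induction z)
  case (Suc z)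
  have "gw_step_gt F a (\<lambda>_. 1) (Suc z) \<le> ennreal (tail F a) + ennreal (tail F a) * of_nat z"
    using gw_step_gt_one_Suc_le Suc by (meson add_left_mono order_trans)
  then show ?case by (simp add: distrib_left)
qed (simp add: gw_step_gt_one_0)

text \<open>A Bonferroni inequality. The quadratic error is affordable because the second moment of
  generation \<open>i\<close> is of order \<open>m ^ (2 * i)\<close>, the square of its
  mean.\<close>

lemma gw_step_gt_one_ge:
  "ennreal (tail F a) * of_nat z
    \<le> gw_step_gt F a (\<lambda>_. 1) z + ennreal ((tail F a)\<^sup>2) * of_nat (z\<^sup>2)"
proof (induction z)
  case (Suc z)
  let ?t = "ennreal (tail F a)" and ?G = "gw_step_gt F a (\<lambda>_. 1)"
  have t2: "ennreal ((tail F a)\<^sup>2) = ?t * ?t"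
    by (simp add: power2_eq_square ennreal_mult)
  have "?t * of_nat (Suc z) = ?t + ?t * of_nat z"
    by (simp add: distrib_left)
  also have "\<dots> \<le> ?t + (?G z + ?t * ?t * of_nat (z\<^sup>2))"
    using Suc by (simp add: t2 add_left_mono)
  also have "\<dots> \<le> ?G (Suc z) + ?t * ?G z + ?t * ?t * of_nat (z\<^sup>2)"
    using gw_step_gt_one_Suc_ge by (metis add.assoc add_right_mono)
  also have "\<dots> \<le> ?G (Suc z) + ?t * (?t * of_nat z) + ?t * ?t * of_nat (z\<^sup>2)"
    by (intro add_mono mult_left_mono gw_step_gt_one_le) auto
  also have "\<dots> = ?G (Suc z) + ?t * ?t * of_nat (z + z\<^sup>2)"
    by (simp add: distrib_left ac_simps)
  also have "\<dots> \<le> ?G (Suc z) + ?t * ?t * of_nat ((Suc z)\<^sup>2)"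
    by (intro add_left_mono mult_left_mono of_nat_mono) (auto simp: power2_eq_square)
  finally show ?case by (simp add: t2)
qed simp

section \<open>Moments\<close>

locale gw_offspring =
  fixes F :: "nat pmf"
  assumes mean_gt: "pmf_mean F > 1"
    and second_moment: "integrable (measure_pmf F) (\<lambda>k. real k ^ 2)"
begin

abbreviation "m \<equiv> pmf_mean F"

definition "s2 = measure_pmf.expectation F (\<lambda>k. real k ^ 2)"

text \<open>The variance of the limit \<open>W\<close> for one ancestor: \<open>V_eq\<close> divided
  by \<open>m\<^sup>2\<close> is the fixed point equation of the variance recursion. Using the limit
  in place of the variance of \<open>W_n\<close> frees the bounds of \<open>n\<close>.\<close>

definition "V = (s2 - m\<^sup>2) / (m * (m - 1))"

lemma m_pos: "m > 0" using mean_gt by simp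

lemma integrable_real: "integrable (measure_pmf F) real"
proof (rule Bochner_Integration.integrable_bound)
  show "integrable (measure_pmf F) (\<lambda>k. 1 + real k ^ 2)"
    using second_moment by auto
  have "real k \<le> 1 + (real k)\<^sup>2" for k
    using sum_squares_ge_zero [of "real k - 1" "real k"] by (simp add: power2_eq_square algebra_simps)
  then show "AE k in F. norm (real k) \<le> norm (1 + (real k)\<^sup>2)"
    by auto
qed auto

lemma nn_integral_real: "(\<integral>\<^sup>+k. ennreal (real k) \<partial>F) = ennreal m"
  by (subst nn_integral_eq_integral [OF integrable_real]) (auto simp: pmf_mean_def)

lemma nn_integral_square: "(\<integral>\<^sup>+k. ennreal ((real k - b)\<^sup>2) \<partial>F) = ennreal (s2 - m\<^sup>2 + (m - b)\<^sup>2)"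
proof -
  have int: "integrable F (\<lambda>k. (real k)\<^sup>2 - (2 * b) * real k + b\<^sup>2)"
    using integrable_real second_moment by auto
  have eq: "(real k - b)\<^sup>2 = (real k)\<^sup>2 - (2 * b) * real k + b\<^sup>2" for k
    by (simp add: power2_eq_square algebra_simps)
  have "(\<integral>k. (real k)\<^sup>2 - (2 * b) * real k + b\<^sup>2 \<partial>F) = s2 - (2 * b) * m + b\<^sup>2"
    using integrable_real second_moment
    by (simp add: s2_def pmf_mean_def integrable_diff)
  then have "(\<integral>\<^sup>+k. ennreal ((real k - b)\<^sup>2) \<partial>F) = ennreal (s2 - (2 * b) * m + b\<^sup>2)"
    using nn_integral_eq_integral [OF int] by (simp flip: eq)
  also have "s2 - (2 * b) * m + b\<^sup>2 = s2 - m\<^sup>2 + (m - b)\<^sup>2"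
    by (simp add: power2_eq_square algebra_simps)
  finally show ?thesis .
qed

lemma variance_nonneg: "s2 - m\<^sup>2 \<ge> 0"
proof -
  have "(\<integral>k. (real k - m)\<^sup>2 \<partial>F) \<ge> 0" by (intro integral_nonneg_AE) auto
  also have "(\<integral>k. (real k - m)\<^sup>2 \<partial>F) = (\<integral>k. (real k)\<^sup>2 - (2 * m) * real k + m\<^sup>2 \<partial>F)"
    by (simp add: power2_eq_square algebra_simps)
  also have "\<dots> = s2 - (2 * m) * m + m\<^sup>2"
    using integrable_real second_moment
    by (simp add: s2_def pmf_mean_def integrable_diff)
  finally show ?thesis by (simp add: power2_eq_square)
qed

lemma s2_nonneg: "s2 \<ge> 0" using variance_nonneg by (smt (verit) zero_le_power2)

lemma V_nonneg: "V \<ge> 0"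
  using variance_nonneg mean_gt by (simp add: V_def)

lemma V_eq: "m * V + (s2 - m\<^sup>2) = m\<^sup>2 * V"
  using mean_gt by (simp add: V_def field_simps power2_eq_square)

lemma gw_step_real: "gw_step F (\<lambda>z. ennreal (real z)) z = ennreal (real z * m)"
proof (induction z)
  case (Suc z)
  have "gw_step F (\<lambda>z. ennreal (real z)) (Suc z)
      = (\<integral>\<^sup>+k. ennreal (real k) + gw_step F (\<lambda>z. ennreal (real z)) z \<partial>F)"
    unfolding gw_step_def nn_integral_replicate_pmf_Suc
    by (simp add: nn_integral_add measure_pmf.emeasure_space_1 [simplified])
  also have "\<dots> = ennreal m + ennreal (real z * m)"
    by (subst nn_integral_add) (auto simp: nn_integral_real Suc measure_pmf.emeasure_space_1 [simplified])
  finally show ?case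
    using m_pos by (simp add: distrib_right flip: ennreal_plus)
qed (simp add: gw_step_def)

text \<open>The centre \<open>b\<close> is arbitrary because splitting off an individual with
  \<open>k\<close> children moves the centre to \<open>b - k\<close> in the induction.\<close>

lemma gw_step_square:
  "gw_step F (\<lambda>z. ennreal ((real z - b)\<^sup>2)) z = ennreal (real z * (s2 - m\<^sup>2) + (real z * m - b)\<^sup>2)"
proof (induction z arbitrary: b)
  case (Suc z)
  have *: "real z * m - (b - k) = k - (b - real z * m)" for k by simp
  have "gw_step F (\<lambda>z. ennreal ((real z - b)\<^sup>2)) (Suc z)
      = (\<integral>\<^sup>+k. gw_step F (\<lambda>z. ennreal ((real z - (b - real k))\<^sup>2)) z \<partial>F)"
    unfolding gw_step_def nn_integral_replicate_pmf_Suc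
    by (intro nn_integral_cong) (simp add: algebra_simps)
  also have "\<dots> = (\<integral>\<^sup>+k. ennreal (real z * (s2 - m\<^sup>2)) + ennreal ((real k - (b - real z * m))\<^sup>2) \<partial>F)"
    unfolding Suc * using variance_nonneg by (intro nn_integral_cong) (subst ennreal_plus, auto)
  also have "\<dots> = ennreal (real z * (s2 - m\<^sup>2)) + ennreal (s2 - m\<^sup>2 + (m - (b - real z * m))\<^sup>2)"
    by (subst nn_integral_add) (auto simp: nn_integral_square measure_pmf.emeasure_space_1 [simplified])
  also have "\<dots> = ennreal (real z * (s2 - m\<^sup>2) + (s2 - m\<^sup>2 + (m - (b - real z * m))\<^sup>2))"
    using variance_nonneg by (subst ennreal_plus) auto
  finally show ?case by (simp add: algebra_simps)
qed (simp add: gw_step_def)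

lemma gw_iter_real: "(gw_step F ^^ n) (\<lambda>z. ennreal (real z)) z = ennreal (real z * m ^ n)"
proof (induction n arbitrary: z)
  case (Suc n)
  have *: "(gw_step F ^^ n) (\<lambda>z. ennreal (real z)) = (\<lambda>z. ennreal (m ^ n) * ennreal (real z))"
    using m_pos by (auto simp: Suc ennreal_mult' [symmetric] ac_simps)
  show ?case
    unfolding funpow.simps o_apply * gw_step_cmult gw_step_real
    using m_pos by (simp add: ennreal_mult' [symmetric] ac_simps)
qed simp

text \<open>The right-hand side is reproduced exactly by one further step, by \<open>V_eq\<close>;
  the only loss is in the case \<open>n = 0\<close>, where the term \<open>real z * V\<close> is
  added.\<close>

lemma gw_iter_square_le:
  "(gw_step F ^^ n) (\<lambda>z. ennreal ((real z - b)\<^sup>2)) z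
    \<le> ennreal (m ^ (2 * n) * (real z * V + (real z - b / m ^ n)\<^sup>2))"
proof (induction n arbitrary: z)
  case 0 then show ?case using V_nonneg by (auto intro!: ennreal_leI)
next
  case (Suc n)
  let ?M = "m ^ (2 * n)"
  have "(gw_step F ^^ Suc n) (\<lambda>z. ennreal ((real z - b)\<^sup>2)) z
      \<le> gw_step F (\<lambda>z. ennreal (?M * (real z * V + (real z - b / m ^ n)\<^sup>2))) z"
    by (simp, intro gw_step_mono Suc)
  also have "(\<lambda>z. ennreal (?M * (real z * V + (real z - b / m ^ n)\<^sup>2)))
      = (\<lambda>z. ennreal (?M * V) * ennreal (real z) + ennreal ?M * ennreal ((real z - b / m ^ n)\<^sup>2))"
    using m_pos V_nonneg
    by (intro ext) (simp add: ennreal_mult' [symmetric] ennreal_plus [symmetric] algebra_simps del: ennreal_plus)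
  also have "gw_step F \<dots> z = ennreal (?M * V) * ennreal (real z * m)
      + ennreal ?M * ennreal (real z * (s2 - m\<^sup>2) + (real z * m - b / m ^ n)\<^sup>2)"
    by (simp add: gw_step_linear gw_step_real gw_step_square)
  also have "\<dots> = ennreal (?M * V * (real z * m) + ?M * (real z * (s2 - m\<^sup>2) + (real z * m - b / m ^ n)\<^sup>2))"
    using m_pos V_nonneg variance_nonneg
    by (simp add: ennreal_mult' [symmetric] ennreal_plus [symmetric] del: ennreal_plus)
  also have "?M * V * (real z * m) + ?M * (real z * (s2 - m\<^sup>2) + (real z * m - b / m ^ n)\<^sup>2)
      = ?M * (real z * (m * V + (s2 - m\<^sup>2)) + (real z * m - b / m ^ n)\<^sup>2)"
    by (simp add: algebra_simps)
  also have "\<dots> = m ^ (2 * Suc n) * (real z * V + (real z - b / m ^ Suc n)\<^sup>2)"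
  proof -
    have *: "real z * m - b / m ^ n = m * (real z - b / m ^ Suc n)"
      using m_pos by (simp add: right_diff_distrib)
    show ?thesis
      unfolding V_eq * power_mult_distrib by (simp add: power2_eq_square distrib_left)
  qed
  finally show ?case .
qed

lemma gw_iter_square_one_le:
  "(gw_step F ^^ n) (\<lambda>z. ennreal ((real z)\<^sup>2)) 1 \<le> ennreal ((V + 1) * m ^ (2 * n))"
  using gw_iter_square_le [of n 0 1] by (simp add: mult.commute)

end

text \<open>The sum of \<open>sum_list xs - k\<close> over all entries \<open>k > a\<close> of \<open>xs\<close>, counted with multiplicity.\<close>

fun jump_rest :: "real \<Rightarrow> nat list \<Rightarrow> nat" where
  "jump_rest a [] = 0"
| "jump_rest a (k # xs) = (if a < real k then sum_list xs else 0) + jump_rest a xs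
     + k * length (filter (\<lambda>j. a < real j) xs)"

text \<open>The entries other than one copy of the big entry \<open>k\<close> form a single summand
  of \<open>jump_rest\<close>. Hence a sum near \<open>y\<close> without an entry near
  \<open>y\<close>, but with one above \<open>a\<close>, forces a large
  \<open>jump_rest\<close>.\<close>

lemma jump_rest_ge:
  "k \<in> set xs \<Longrightarrow> a < real k \<Longrightarrow> sum_list xs \<le> jump_rest a xs + k"
proof (induction xs)
  case (Cons l xs)
  show ?case
  proof (cases "k = l")
    case True
    then show ?thesis using Cons by auto
  next
    case False
    then have k: "k \<in> set xs" using Cons by auto
    then have "filter (\<lambda>j. a < real j) xs \<noteq> []"
      using Cons.prems by (auto simp: filter_empty_conv)
    then have "1 \<le> length (filter (\<lambda>j. a < real j) xs)"
      by (simp add: Suc_leI)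
    then have "l \<le> l * length (filter (\<lambda>j. a < real j) xs)"
      by (metis mult.right_neutral mult_le_mono2)
    with Cons.IH [OF k Cons.prems(2)] show ?thesis
      by (cases "a < real l"; simp only: jump_rest.simps sum_list.Cons if_True if_False; linarith)
  qed
qed simp

section \<open>Upper estimates for a jump in one generation\<close>

context gw_offspring
begin

lemma nn_integral_count_gt:
  "(\<integral>\<^sup>+xs. of_nat (length (filter (\<lambda>j. a < real j) xs)) \<partial>replicate_pmf z F)
    = ennreal (tail F a) * of_nat z"
proof (induction z)
  case (Suc z)
  let ?c = "\<lambda>xs. of_nat (length (filter (\<lambda>j. a < real j) xs)) :: ennreal"
  have "(\<integral>\<^sup>+xs. ?c xs \<partial>replicate_pmf (Suc z) F)
      = (\<integral>\<^sup>+k. indicator {k. a < real k} k + (\<integral>\<^sup>+xs. ?c xs \<partial>replicate_pmf z F) \<partial>F)"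
    unfolding nn_integral_replicate_pmf_Suc
    by (intro nn_integral_cong)
      (auto simp: indicator_def nn_integral_add measure_pmf.emeasure_space_1 [simplified])
  also have "\<dots> = ennreal (tail F a) + ennreal (tail F a) * of_nat z"
    unfolding Suc
    by (subst nn_integral_add)
      (auto simp: tail_def measure_pmf.emeasure_eq_measure measure_pmf.emeasure_space_1 [simplified])
  finally show ?case by (simp add: distrib_left)
qed simp

text \<open>Each ordered pair of different positions contributes \<open>tail F a * m\<close> by
  independence, and there are fewer than \<open>z\<^sup>2\<close> pairs when
  \<open>z > 0\<close>.\<close>

lemma nn_integral_jump_rest_le:
  "(\<integral>\<^sup>+xs. of_nat (jump_rest a xs) \<partial>replicate_pmf z F) \<le> ennreal (tail F a * m) * of_nat (z\<^sup>2)"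
proof (induction z)
  case (Suc z)
  let ?t = "ennreal (tail F a)"
  let ?E = "\<lambda>f. \<integral>\<^sup>+xs. of_nat (f xs) \<partial>replicate_pmf z F :: ennreal"
  let ?c = "\<lambda>xs. length (filter (\<lambda>j. a < real j) xs)"
  have sum: "?E sum_list = ennreal (real z * m)"
    using gw_step_real [of z] by (simp add: gw_step_def ennreal_of_nat_eq_real_of_nat)
  have "(\<integral>\<^sup>+xs. of_nat (jump_rest a xs) \<partial>replicate_pmf (Suc z) F)
      = (\<integral>\<^sup>+k. indicator {k. a < real k} k * ?E sum_list + (?E (jump_rest a) + of_nat k * ?E ?c) \<partial>F)"
    unfolding nn_integral_replicate_pmf_Suc
    by (intro nn_integral_cong) (simp add: indicator_def nn_integral_add nn_integral_cmult ac_simps)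
  also have "\<dots> = ?t * ?E sum_list + (?E (jump_rest a) + ennreal m * ?E ?c)"
    using nn_integral_real
    by (simp add: nn_integral_add nn_integral_multc tail_def measure_pmf.emeasure_eq_measure
        measure_pmf.emeasure_space_1 [simplified] ennreal_of_nat_eq_real_of_nat)
  also have "\<dots> \<le> ?t * ennreal (real z * m) + (ennreal (tail F a * m) * of_nat (z\<^sup>2)
      + ennreal m * (?t * of_nat z))"
    unfolding sum nn_integral_count_gt by (intro add_left_mono add_right_mono Suc)
  also have "\<dots> = ennreal (tail F a * m * (real z * 2 + real z ^ 2))"
    using m_pos by (simp add: ennreal_of_nat_eq_real_of_nat ennreal_mult' [symmetric]
        ennreal_plus [symmetric] algebra_simps del: ennreal_plus of_nat_power)
  also have "\<dots> \<le> ennreal (tail F a * m * (real (Suc z))\<^sup>2)"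
    using m_pos by (intro ennreal_leI mult_left_mono) (auto simp: power2_eq_square algebra_simps)
  finally show ?case
    using m_pos by (simp add: ennreal_of_nat_eq_real_of_nat ennreal_mult' [symmetric])
qed simp

text \<open>Here \<open>g\<close> is the chance that the later generations succeed. Given an entry
  above \<open>a\<close>, either the sum stays below \<open>y - h / 2\<close> and success has chance
  at most \<open>\<kappa>\<close>, or some entry exceeds \<open>y - h\<close>, or the siblings of
  the jump supply at least \<open>h / 2\<close>, which Markov's inequality for
  \<open>jump_rest\<close> controls.\<close>

lemma gw_step_gt_upper:
  assumes g1: "\<And>w. g w \<le> 1" and g: "\<And>w. real w \<le> y - h / 2 \<Longrightarrow> g w \<le> ennreal \<kappa>" and h: "h > 0"
  shows "gw_step_gt F a g z \<le> ennreal \<kappa> * (ennreal (tail F a) * of_nat z)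
     + ennreal (tail F (y - h)) * of_nat z + ennreal (2 / h * (tail F a * m)) * of_nat (z\<^sup>2)"
proof -
  let ?R = "replicate_pmf z F"
  let ?B = "\<lambda>a. {xs. \<exists>k\<in>set xs. a < real k}"
  have pt: "g (sum_list xs) * indicator (?B a) xs
     \<le> ennreal \<kappa> * indicator (?B a) xs + (indicator (?B (y - h)) xs + ennreal (2 / h) * of_nat (jump_rest a xs))"
    (is "?l \<le> ?c1 + (?c2 + ?c3)") for xs
  proof (cases "xs \<in> ?B a")
    case True
    then obtain k where k: "k \<in> set xs" "a < real k" by auto
    consider "real (sum_list xs) \<le> y - h / 2" | "xs \<in> ?B (y - h)"
      | "real (sum_list xs) > y - h / 2" "xs \<notin> ?B (y - h)" by fastforce
    then show ?thesis
    proof cases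
      case 1
      then have "?l \<le> ?c1" using g by (intro mult_right_mono) auto
      then show ?thesis by (rule add_increasing2 [OF zero_le])
    next
      case 2
      then have "?l \<le> ?c2" using g1 True by simp
      then show ?thesis by (intro add_increasing [OF zero_le] add_increasing2 [OF zero_le])
    next
      case 3
      then have "real k \<le> y - h" using k by (auto simp: not_less)
      moreover have "real (sum_list xs) \<le> real (jump_rest a xs) + real k"
        using jump_rest_ge [OF k] by linarith
      ultimately have "real (jump_rest a xs) \<ge> h / 2" using 3 by simp
      then have "1 \<le> 2 / h * real (jump_rest a xs)" using h by (simp add: field_simps)
      then have "1 \<le> ?c3"
        using h by (simp add: ennreal_of_nat_eq_real_of_nat ennreal_mult' [symmetric])
      moreover have "?l \<le> 1" using g1 True by simp
      ultimately have "?l \<le> ?c3" by (rule order_trans [rotated])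
      then show ?thesis by (intro add_increasing [OF zero_le])
    qed
  qed auto
  have "gw_step_gt F a g z \<le> (\<integral>\<^sup>+xs. ennreal \<kappa> * indicator (?B a) xs
     + (indicator (?B (y - h)) xs + ennreal (2 / h) * of_nat (jump_rest a xs)) \<partial>?R)"
    unfolding gw_step_gt_def by (intro nn_integral_mono pt)
  also have "\<dots> = ennreal \<kappa> * gw_step_gt F a (\<lambda>_. 1) z + (gw_step_gt F (y - h) (\<lambda>_. 1) z
     + ennreal (2 / h) * (\<integral>\<^sup>+xs. of_nat (jump_rest a xs) \<partial>?R))"
    unfolding gw_step_gt_def by (simp add: nn_integral_add nn_integral_cmult)
  also have "\<dots> \<le> ennreal \<kappa> * (ennreal (tail F a) * of_nat z) + (ennreal (tail F (y - h)) * of_nat z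
     + ennreal (2 / h) * (ennreal (tail F a * m) * of_nat (z\<^sup>2)))"
    by (intro add_mono mult_left_mono gw_step_gt_one_le nn_integral_jump_rest_le) auto
  also have "\<dots> = ennreal \<kappa> * (ennreal (tail F a) * of_nat z)
     + ennreal (tail F (y - h)) * of_nat z + ennreal (2 / h * (tail F a * m)) * of_nat (z\<^sup>2)"
    using ennreal_mult [of "2 / h" "tail F a * m"] h m_pos by (simp only: add.assoc) (simp add: mult.assoc)
  finally show ?thesis .
qed

lemma gw_iter_gt_one_le:
  "(gw_step F ^^ n) (gw_step_gt F a (\<lambda>_. 1)) 1 \<le> ennreal (tail F a * m ^ n)"
proof -
  have "(gw_step F ^^ n) (gw_step_gt F a (\<lambda>_. 1)) 1
     \<le> (gw_step F ^^ n) (\<lambda>z. ennreal (tail F a) * ennreal (real z)) 1"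
    by (intro gw_iter_mono) (use gw_step_gt_one_le in \<open>simp add: ennreal_of_nat_eq_real_of_nat\<close>)
  also have "\<dots> = ennreal (tail F a * m ^ n)"
    using m_pos by (simp add: gw_iter_cmult gw_iter_real ennreal_mult)
  finally show ?thesis .
qed

lemma gw_iter_gt_upper:
  assumes g1: "\<And>w. g w \<le> 1" and g: "\<And>w. real w \<le> y - h / 2 \<Longrightarrow> g w \<le> ennreal \<kappa>"
    and h: "h > 0" and \<kappa>: "\<kappa> \<ge> 0"
  shows "(gw_step F ^^ n) (gw_step_gt F a g) 1
    \<le> ennreal (\<kappa> * tail F a * m ^ n + tail F (y - h) * m ^ n + 2 / h * (tail F a * m) * ((V + 1) * m ^ (2 * n)))"
proof -
  let ?p = "ennreal (\<kappa> * tail F a + tail F (y - h))" and ?q = "ennreal (2 / h * (tail F a * m))"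
  have "(gw_step F ^^ n) (gw_step_gt F a g) 1
     \<le> (gw_step F ^^ n) (\<lambda>z. ?p * ennreal (real z) + ?q * ennreal ((real z)\<^sup>2)) 1"
  proof (intro gw_iter_mono)
    fix z
    show "gw_step_gt F a g z \<le> ?p * ennreal (real z) + ?q * ennreal ((real z)\<^sup>2)"
      using gw_step_gt_upper [of g y h \<kappa> a z] g1 g h \<kappa>
      by (simp add: ennreal_of_nat_eq_real_of_nat ennreal_mult distrib_right mult.assoc)
  qed
  also have "\<dots> \<le> ?p * ennreal (m ^ n) + ?q * ennreal ((V + 1) * m ^ (2 * n))"
    using gw_iter_real [of n 1] gw_iter_square_one_le [of n]
    unfolding gw_iter_linear by (intro add_mono mult_left_mono) auto
  also have "\<dots> = ennreal (\<kappa> * tail F a * m ^ n + tail F (y - h) * m ^ n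
      + 2 / h * (tail F a * m) * ((V + 1) * m ^ (2 * n)))"
    using h \<kappa> m_pos V_nonneg
    by (simp add: ennreal_mult' [symmetric] ennreal_plus [symmetric] distrib_right del: ennreal_plus)
  finally show ?thesis .
qed

section \<open>Chebyshev bounds for the generations after a jump\<close>

lemma gw_chebyshev:
  assumes "r > 0"
  shows "(gw_step F ^^ k) (indicator {z. \<bar>real z - m ^ k * real w\<bar> \<ge> m ^ k * r}) w \<le> ennreal (real w * V / r\<^sup>2)"
proof -
  let ?A = "{z. \<bar>real z - m ^ k * real w\<bar> \<ge> m ^ k * r}"
  have mk: "m ^ k * r > 0" using m_pos assms by simp
  have "indicator ?A z \<le> ennreal (1 / (m ^ k * r)\<^sup>2) * ennreal ((real z - m ^ k * real w)\<^sup>2)" for z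
  proof (cases "z \<in> ?A")
    case True
    then have "(m ^ k * r)\<^sup>2 \<le> \<bar>real z - m ^ k * real w\<bar>\<^sup>2"
      using mk by (intro power_mono) auto
    then have "1 \<le> 1 / (m ^ k * r)\<^sup>2 * (real z - m ^ k * real w)\<^sup>2"
      using zero_less_power [OF mk, of 2]
      by (simp only: le_divide_eq_1_pos mult_1 times_divide_eq_left power2_abs)
    then have "ennreal 1 \<le> ennreal (1 / (m ^ k * r)\<^sup>2 * (real z - m ^ k * real w)\<^sup>2)"
      by (rule ennreal_leI)
    then show ?thesis using True by (simp add: ennreal_mult' [symmetric])
  qed auto
  then have "(gw_step F ^^ k) (indicator ?A) w
      \<le> (gw_step F ^^ k) (\<lambda>z. ennreal (1 / (m ^ k * r)\<^sup>2) * ennreal ((real z - m ^ k * real w)\<^sup>2)) w"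
    by (rule gw_iter_mono)
  also have "\<dots> \<le> ennreal (1 / (m ^ k * r)\<^sup>2) * ennreal (m ^ (2 * k) * (real w * V))"
    unfolding gw_iter_cmult using gw_iter_square_le [of k "m ^ k * real w" w] m_pos mean_gt
    by (intro mult_left_mono) auto
  also have "\<dots> = ennreal (1 / (m ^ k * r)\<^sup>2 * (m ^ (2 * k) * (real w * V)))"
    by (simp add: ennreal_mult' [symmetric])
  \<comment> \<open>The factors \<open>m ^ (2 * k)\<close> cancel: the bound does not depend on the
    number \<open>k\<close> of generations.\<close>
  also have "1 / (m ^ k * r)\<^sup>2 * (m ^ (2 * k) * (real w * V)) = real w * V / r\<^sup>2"
    using m_pos mean_gt assms by (simp add: power_mult_distrib power_even_eq)
  finally show ?thesis .
qed

lemma gw_iter_gt_le: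
  assumes "real w < y"
  shows "(gw_step F ^^ k) (indicator {z. m ^ k * y < real z}) w \<le> ennreal (real w * V / (y - real w)\<^sup>2)"
proof -
  have "(gw_step F ^^ k) (indicator {z. m ^ k * y < real z}) w
    \<le> (gw_step F ^^ k) (indicator {z. \<bar>real z - m ^ k * real w\<bar> \<ge> m ^ k * (y - real w)}) w"
    by (intro gw_iter_mono) (auto simp: indicator_def algebra_simps)
  also have "\<dots> \<le> ennreal (real w * V / (y - real w)\<^sup>2)"
    using assms by (intro gw_chebyshev) simp
  finally show ?thesis .
qed

lemma gw_iter_gt_ge:
  assumes "y < real w"
  shows "1 \<le> (gw_step F ^^ k) (indicator {z. m ^ k * y < real z}) w + ennreal (real w * V / (real w - y)\<^sup>2)"
proof -
  have "1 = (gw_step F ^^ k) (\<lambda>_. 1) w" by (simp add: gw_iter_one)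
  also have "\<dots> \<le> (gw_step F ^^ k) (\<lambda>z. indicator {z. m ^ k * y < real z} z
      + indicator {z. \<bar>real z - m ^ k * real w\<bar> \<ge> m ^ k * (real w - y)} z) w"
    by (intro gw_iter_mono) (auto simp: indicator_def algebra_simps)
  also have "\<dots> \<le> (gw_step F ^^ k) (indicator {z. m ^ k * y < real z}) w + ennreal (real w * V / (real w - y)\<^sup>2)"
    unfolding gw_iter_add using assms by (intro add_left_mono gw_chebyshev) simp
  finally show ?thesis .
qed

section \<open>Exponential moments without big jumps\<close>

text \<open>The inequality \<open>exp u \<le> 1 + u * exp u\<close> is applied twice. The factor
  \<open>exp u\<close> stays in the quadratic term only, where truncation will bound it.\<close>

lemma exp_le_quadratic: "exp u \<le> 1 + u + u\<^sup>2 * exp u" if "0 \<le> u" for u :: real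
proof -
  have "1 - u \<le> exp (- u)" using exp_ge_add_one_self [of "- u"] by simp
  then have "(1 - u) * exp u \<le> 1"
    by (metis exp_minus_inverse exp_ge_zero mult.commute mult_left_mono)
  then have 1: "exp u \<le> 1 + u * exp u" by (simp add: algebra_simps)
  then have "u * exp u \<le> u * (1 + u * exp u)" using that by (intro mult_left_mono)
  with 1 show ?thesis by (simp add: power2_eq_square algebra_simps)
qed

text \<open>Truncation is spent on the quadratic remainder alone; the linear term carries the full
  mean \<open>m\<close>, so to first order exponents just get multiplied by
  \<open>m\<close>.\<close>

lemma nn_integral_exp_le:
  assumes b: "0 \<le> b"
  shows "(\<integral>\<^sup>+k. ennreal (exp (b * real k)) * indicator {k. real k \<le> a} k \<partial>F)
    \<le> ennreal (1 + b * m + b\<^sup>2 * s2 * exp (b * a))"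
proof -
  have "ennreal (exp (b * real k)) * indicator {k. real k \<le> a} k
     \<le> ennreal 1 + ennreal b * ennreal (real k) + ennreal (b\<^sup>2 * exp (b * a)) * ennreal ((real k - 0)\<^sup>2)" for k
  proof (cases "real k \<le> a")
    case True
    have "exp (b * real k) \<le> 1 + b * real k + (b * real k)\<^sup>2 * exp (b * real k)"
      using b by (intro exp_le_quadratic) auto
    also have "\<dots> \<le> 1 + b * real k + (b * real k)\<^sup>2 * exp (b * a)"
      using b True by (intro add_left_mono mult_left_mono) (auto intro: mult_left_mono)
    also have "\<dots> = 1 + b * real k + b\<^sup>2 * exp (b * a) * (real k)\<^sup>2"
      by (simp add: power_mult_distrib)
    finally have "ennreal (exp (b * real k)) \<le> ennreal \<dots>" by (rule ennreal_leI)
    then show ?thesis using True b by (simp add: ennreal_mult)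
  qed auto
  then have "(\<integral>\<^sup>+k. ennreal (exp (b * real k)) * indicator {k. real k \<le> a} k \<partial>F)
     \<le> (\<integral>\<^sup>+k. ennreal 1 + ennreal b * ennreal (real k)
          + ennreal (b\<^sup>2 * exp (b * a)) * ennreal ((real k - 0)\<^sup>2) \<partial>F)"
    by (intro nn_integral_mono) 
  also have "\<dots> = ennreal 1 + ennreal b * ennreal m + ennreal (b\<^sup>2 * exp (b * a)) * ennreal s2"
    using nn_integral_square [of 0] nn_integral_real
    by (simp add: nn_integral_add nn_integral_cmult measure_pmf.emeasure_space_1 [simplified])
  also have "\<dots> = ennreal (1 + b * m + b\<^sup>2 * s2 * exp (b * a))"
    using b m_pos s2_nonneg by (simp add: ennreal_mult [symmetric] mult_ac add_nonneg_nonneg)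
  finally show ?thesis .
qed

text \<open>The restriction to entries at most \<open>a\<close> factorises over independent
  siblings, so the truncated exponential moment is a \<open>z\<close>-th power.\<close>

lemma gw_step_le_exp:
  assumes "(\<integral>\<^sup>+k. ennreal (exp (b * real k)) * indicator {k. real k \<le> a} k \<partial>F) \<le> ennreal (exp b')"
  shows "gw_step_le F a (\<lambda>z. ennreal (exp (b * real z))) z \<le> ennreal (exp (b' * real z))"
proof (induction z)
  case (Suc z)
  let ?E = "\<lambda>z. ennreal (exp (b * real z))"
  have "gw_step_le F a ?E (Suc z)
     = (\<integral>\<^sup>+k. (?E k * indicator {k. real k \<le> a} k) * gw_step_le F a ?E z \<partial>F)"
    unfolding gw_step_le_def nn_integral_replicate_pmf_Suc
    by (subst nn_integral_cmult [symmetric], simp, intro nn_integral_cong)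
      (auto simp: indicator_def distrib_left exp_add ennreal_mult mult_ac)
  also have "\<dots> = (\<integral>\<^sup>+k. (?E k * indicator {k. real k \<le> a} k) \<partial>F) * gw_step_le F a ?E z"
    by (simp add: nn_integral_multc)
  also have "\<dots> \<le> ennreal (exp b') * ennreal (exp (b' * real z))"
    by (intro mult_mono assms Suc) auto
  also have "\<dots> = ennreal (exp (b' * real (Suc z)))"
    by (simp add: ennreal_mult [symmetric] exp_add [symmetric] algebra_simps)
  finally show ?case .
qed (simp add: gw_step_le_def)

lemma gw_path_le_exp:
  assumes "\<And>i. i < n \<Longrightarrow>
    (\<integral>\<^sup>+k. ennreal (exp (b (Suc i) * real k)) * indicator {k. real k \<le> a i} k \<partial>F) \<le> ennreal (exp (b i))"
  shows "gw_path_le F a n (\<lambda>z. ennreal (exp (b n * real z))) z \<le> ennreal (exp (b 0 * real z))"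
  using assms
proof (induction n)
  case (Suc n)
  have "gw_path_le F a (Suc n) (\<lambda>z. ennreal (exp (b (Suc n) * real z))) z
     \<le> gw_path_le F a n (\<lambda>z. ennreal (exp (b n * real z))) z"
    using Suc.prems by (simp, intro gw_path_le_mono gw_step_le_exp) auto
  also have "\<dots> \<le> ennreal (exp (b 0 * real z))"
    using Suc by auto
  finally show ?case .
qed simp

text \<open>The exponents \<open>b i = \<lambda> * (1 + 1 / m ^ i) / m ^ i\<close> with \<open>\<lambda> = K * ln x / x\<close> turn the
  recursion for the exponential moments into a supersolution: the second order error in generation
  \<open>i\<close> is of order \<open>\<lambda>\<^sup>2 * sqrt x / m ^ (2 * i)\<close>, and the decreasing factor gains
  \<open>\<lambda> * (1 - 1 / m) / m ^ (2 * i)\<close>.\<close>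

lemma gw_path_le_polynomial:
  assumes K: "K > 0"
  shows "\<forall>\<^sub>F x in at_top. \<forall>n. gw_path_le F (\<lambda>i. 1 / (4 * K) * (m ^ Suc i * x)) n
           (indicator {z. m ^ n * x < real z}) 1 \<le> ennreal (exp 1 * x powr - K)"
proof -
  have "((\<lambda>x. 4 * (K * ln x / x) * s2 * sqrt x) \<longlongrightarrow> 0) at_top" by real_asymp
  then have ev1: "\<forall>\<^sub>F x in at_top. 4 * (K * ln x / x) * s2 * sqrt x < m * (m - 1)"
    using mean_gt by (intro order_tendstoD) auto
  have "((\<lambda>x. K * ln x / x) \<longlongrightarrow> 0) at_top" by real_asymp
  then have ev2: "\<forall>\<^sub>F x in at_top. K * ln x / x < 1 / 2"
    by (intro order_tendstoD) auto
  show ?thesis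
    using ev1 ev2 eventually_gt_at_top [of 1]
  proof eventually_elim
    case (elim x)
    define l where "l = K * ln x / x"
    define b where "b i = l * (1 + 1 / m ^ i) / m ^ i" for i
    have l0: "0 < l" using K elim by (simp add: l_def)
    have el: "4 * l * s2 * sqrt x \<le> m * (m - 1)" using elim by (simp add: l_def)
    have b0: "0 < b i" for i using l0 m_pos by (auto simp: b_def intro!: divide_pos_pos mult_pos_pos add_pos_pos)
    have pw: "1 \<le> m ^ i" for i using mean_gt by simp
    have bl: "b i \<le> 2 * l / m ^ i" for i
      unfolding b_def using pw [of i] l0 m_pos
      by (intro divide_right_mono) (auto simp: field_simps)
    have step: "(\<integral>\<^sup>+k. ennreal (exp (b (Suc i) * real k)) * indicator {k. real k \<le> 1 / (4 * K) * (m ^ Suc i * x)} k \<partial>F)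
       \<le> ennreal (exp (b i))" for i
    proof -
      let ?B = "b (Suc i)" and ?a = "1 / (4 * K) * (m ^ Suc i * x)"
      have "?B * ?a \<le> 2 * l / m ^ Suc i * ?a"
        using K elim m_pos by (intro mult_right_mono bl) auto
      \<comment> \<open>The truncation constant \<open>1 / (4 * K)\<close> is chosen for this
        identity: the truncated exponential then costs only \<open>sqrt x\<close>, which the small
        \<open>l\<close> absorbs.\<close>
      also have "\<dots> = ln x / 2"
        using K elim m_pos mean_gt by (simp add: l_def)
      finally have "exp (?B * ?a) \<le> exp (ln x / 2)" by simp
      also have "\<dots> = sqrt x"
        using elim by (simp add: exp_divide_power_eq ln_sqrt [symmetric])
      finally have e: "exp (?B * ?a) \<le> sqrt x" .
      have "?B\<^sup>2 * s2 * exp (?B * ?a) \<le> (2 * l / m ^ Suc i)\<^sup>2 * s2 * sqrt x"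
        using bl [of "Suc i"] b0 [of "Suc i"] e s2_nonneg by (intro mult_mono power_mono) auto
      also have "\<dots> = l / (m ^ Suc i)\<^sup>2 * (4 * l * s2 * sqrt x)"
        by (simp add: power2_eq_square)
      also have "\<dots> \<le> l / (m ^ Suc i)\<^sup>2 * (m * (m - 1))"
        using el l0 by (intro mult_left_mono) auto
      also have "\<dots> = b i - ?B * m"
        using m_pos mean_gt by (simp add: b_def field_simps power2_eq_square)
      finally have "1 + ?B * m + ?B\<^sup>2 * s2 * exp (?B * ?a) \<le> 1 + b i" by simp
      also have "\<dots> \<le> exp (b i)" by simp
      finally show ?thesis
        using nn_integral_exp_le [of ?B ?a] b0 [of "Suc i"]
        by (meson ennreal_leI less_imp_le order_trans)
    qed
    show ?case
    proof
      fix n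
      let ?a = "\<lambda>i. 1 / (4 * K) * (m ^ Suc i * x)"
      \<comment> \<open>Exponential Markov inequality. It works for every \<open>n\<close> because
        \<open>b n * m ^ n\<close> never falls below \<open>l\<close>.\<close>
      have "indicator {z. m ^ n * x < real z} z \<le> ennreal (exp (- l * x)) * ennreal (exp (b n * real z))" for z
      proof (cases "m ^ n * x < real z")
        case True
        have "l * x \<le> b n * (m ^ n * x)"
          using l0 elim m_pos mean_gt by (simp add: b_def field_simps)
        also have "\<dots> \<le> b n * real z"
          using True b0 [of n] by (intro mult_left_mono) auto
        finally have "1 \<le> exp (- l * x + b n * real z)" by simp
        then have "ennreal 1 \<le> ennreal (exp (- l * x + b n * real z))" by (rule ennreal_leI)
        then show ?thesis using True by (simp only: exp_add) (simp add: ennreal_mult)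
      qed auto
      then have "gw_path_le F ?a n (indicator {z. m ^ n * x < real z}) 1
         \<le> gw_path_le F ?a n (\<lambda>z. ennreal (exp (- l * x)) * ennreal (exp (b n * real z))) 1"
        by (rule gw_path_le_mono)
      also have "\<dots> \<le> ennreal (exp (- l * x)) * ennreal (exp (b 0 * real 1))"
        unfolding gw_path_le_cmult by (intro mult_left_mono gw_path_le_exp step) auto
      \<comment> \<open>Here \<open>b 0 = 2 * l\<close> is below 1, since
        \<open>l < 1 / 2\<close>.\<close>
      also have "\<dots> \<le> ennreal (exp (- l * x)) * ennreal (exp 1)"
        using elim by (intro mult_left_mono ennreal_leI) (auto simp: b_def l_def)
      also have "\<dots> = ennreal (exp 1 * x powr - K)"
        using elim by (simp add: ennreal_mult [symmetric] l_def powr_def mult.commute)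
      finally show "gw_path_le F ?a n (indicator {z. m ^ n * x < real z}) 1 \<le> ennreal (exp 1 * x powr - K)" .
    qed
  qed
qed

end

section \<open>Regularity of the tail\<close>

locale heavy_offspring = gw_offspring +
  fixes \<delta> c \<gamma> :: real
  assumes dom_var: "\<exists>C. \<forall>x::real. tail F (x / 2) \<le> C * tail F x"
    and delta_pos: "\<delta> > 0"
    and bound: "\<And>x y. x > 1 \<Longrightarrow> y > 1 \<Longrightarrow> tail F (x * y) \<le> c * tail F x / y powr (1 + \<delta>)"
    and gamma: "\<gamma> > 1/2"
    and insens: "(\<lambda>x. tail F (x + x powr \<gamma>)) \<sim>[at_top] tail F"
begin

abbreviation "t \<equiv> tail F"

lemma tail_halving: "\<exists>C\<ge>1. \<forall>x n. t (x / 2 ^ n) \<le> C ^ n * t x"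
proof -
  obtain C where C: "\<And>x. t (x / 2) \<le> C * t x" using dom_var by auto
  define D where "D = max C 1"
  have D: "t (x / 2) \<le> D * t x" for x
    using C [of x] tail_nonneg [of F x] unfolding D_def
    by (smt (verit, best) max.cobounded1 mult_right_mono)
  have "t (x / 2 ^ n) \<le> D ^ n * t x" for x n
  proof (induction n)
    case (Suc n)
    have "t (x / 2 ^ Suc n) \<le> D * t (x / 2 ^ n)" using D [of "x / 2 ^ n"] by (simp add: mult.commute)
    also have "\<dots> \<le> D * (D ^ n * t x)" using Suc by (intro mult_left_mono) (auto simp: D_def)
    finally show ?case by simp
  qed simp
  moreover have "D \<ge> 1" by (simp add: D_def)
  ultimately show ?thesis by blast
qed

text \<open>By dominated variation a zero of the tail would propagate down to
  \<open>x / 2 ^ n < 1\<close>; the offspring number would then vanish almost surely, against a mean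
  above 1.\<close>

lemma tail_pos: "t x > 0"
proof (rule ccontr)
  assume "\<not> t x > 0"
  then have 0: "t x = 0" using tail_nonneg [of F x] by linarith
  obtain C where C: "\<And>x n. t (x / 2 ^ n) \<le> C ^ n * t x" using tail_halving by blast
  obtain n :: nat where n: "max x 1 < 2 ^ n"
    using real_arch_pow [of 2 "max x 1"] by auto
  have "t (max x 1) \<le> 0" using tail_antimono [of x "max x 1" F] 0 by simp
  then have "t (max x 1) = 0" using tail_nonneg [of F "max x 1"] by linarith
  then have "t (max x 1 / 2 ^ n) = 0" using C [of "max x 1" n] tail_nonneg by (metis antisym mult_zero_right)
  then have 1: "set_pmf F \<inter> {k. real k > max x 1 / 2 ^ n} = {}"
    by (simp add: tail_def measure_pmf_zero_iff)
  have 2: "max x 1 / 2 ^ n < 1" using n by simp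
  have "real k < 1" if "k \<in> set_pmf F" for k
  proof -
    have "\<not> real k > max x 1 / 2 ^ n" using that 1 by auto
    then show ?thesis using 2 by linarith
  qed
  then have "\<forall>k\<in>set_pmf F. k = 0" by simp
  then have "pmf_mean F = measure_pmf.expectation F (\<lambda>_. 0)"
    unfolding pmf_mean_def by (intro integral_cong_AE) (auto simp: AE_measure_pmf_iff)
  then show False using mean_gt by simp
qed

lemma tail_dominated:
  assumes "\<eta> > 0"
  shows "\<exists>C\<ge>1. \<forall>x>0. t (\<eta> * x) \<le> C * t x"
proof -
  obtain C where C: "C \<ge> 1" "\<And>x n. t (x / 2 ^ n) \<le> C ^ n * t x" using tail_halving by blast
  obtain n where n: "(1 / 2) ^ n < \<eta>" using real_arch_pow_inv [OF assms, of "1 / 2"] by auto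
  have "t (\<eta> * x) \<le> C ^ n * t x" if "x > 0" for x
  proof -
    have "x / 2 ^ n \<le> \<eta> * x"
      using mult_right_mono [OF less_imp_le [OF n], of x] that by (simp add: power_one_over)
    then show ?thesis using C(2) [of x n] tail_antimono [of "x / 2 ^ n" "\<eta> * x" F] by linarith
  qed
  then show ?thesis using C(1) by (meson one_le_power)
qed

text \<open>Ratio of the decay over generations: \<open>bound\<close> with \<open>y = m ^ i\<close>
  yields a factor \<open>m ^ i\<close> to the power \<open>- (1 + \<delta>)\<close>, of which the
  \<open>m ^ i\<close> individuals use up one power.\<close>

definition "r = m powr - \<delta>"

lemma r_pos: "0 < r" and r_less_1: "r < 1"
  using mean_gt delta_pos by (auto simp: r_def powr_less_one)

lemma tail_geometric:
  "\<exists>c'\<ge>1. \<forall>x\<ge>1. \<forall>i. m ^ i * t (m ^ Suc i * x) \<le> c' * t (m * x) * r ^ i"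
proof (intro exI conjI allI impI)
  \<comment> \<open>The maximum with 1 covers \<open>i = 0\<close>, which \<open>bound\<close> does
    not reach because it needs \<open>y > 1\<close>.\<close>
  show "max c 1 \<ge> 1" by simp
  fix x :: real and i :: nat assume x: "x \<ge> 1"
  show "m ^ i * t (m ^ Suc i * x) \<le> max c 1 * t (m * x) * r ^ i"
  proof (cases "i = 0")
    case True
    then show ?thesis using tail_nonneg [of F "m * x"] mult_right_mono [of 1 "max c 1" "t (m * x)"] by simp
  next
    case False
    have mi: "m ^ i > 1" using False mean_gt by simp
    have "1 * 1 < m * x" using x mean_gt by (intro mult_less_le_imp_less) auto
    then have "t (m * x * m ^ i) \<le> c * t (m * x) / (m ^ i) powr (1 + \<delta>)"
      using bound [of "m * x" "m ^ i"] mi by simp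
    then have "m ^ i * t (m ^ Suc i * x) \<le> m ^ i * (c * t (m * x) / (m ^ i) powr (1 + \<delta>))"
      using mi by (intro mult_left_mono) (auto simp: mult_ac)
    also have "\<dots> = c * t (m * x) * (m ^ i) powr - \<delta>"
      using mi m_pos by (simp add: powr_add powr_minus divide_inverse)
    also have "(m ^ i) powr - \<delta> = r ^ i"
      using m_pos by (simp add: r_def powr_powr powr_realpow [symmetric] mult.commute)
    also have "c * t (m * x) * r ^ i \<le> max c 1 * t (m * x) * r ^ i"
      using r_pos by (intro mult_right_mono) auto
    finally show ?thesis .
  qed
qed

text \<open>About \<open>log 2 x\<close> halvings lead from \<open>x\<close> to a point at most 1,
  each costing a factor \<open>C\<close>. The \<open>+ 1\<close> in the exponent makes it positive
  even for \<open>C = 1\<close>.\<close>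

lemma tail_ge_power: "\<exists>K>0. \<exists>c0>0. \<forall>x\<ge>1. c0 * x powr - K \<le> t x"
proof -
  obtain C where C: "C \<ge> 1" "\<And>x n. t (x / 2 ^ n) \<le> C ^ n * t x" using tail_halving by blast
  let ?K = "log 2 C + 1"
  have K: "?K > 0" using C by (simp add: add_nonneg_pos)
  have "t 1 / C * x powr - ?K \<le> t x" if x: "x \<ge> 1" for x
  proof -
    define n where "n = nat \<lceil>log 2 x\<rceil>"
    have l: "log 2 x \<ge> 0" using x by simp
    have n: "log 2 x \<le> real n" "real n \<le> log 2 x + 1" using l unfolding n_def by linarith+
    have "x = 2 powr (log 2 x)" using x by simp
    also have "\<dots> \<le> 2 powr real n" using n by (intro powr_mono) auto
    also have "\<dots> = 2 ^ n" by (simp add: powr_realpow)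
    finally have "x / 2 ^ n \<le> 1" by simp
    then have 1: "t 1 \<le> C ^ n * t x" using C(2) [of x n] tail_antimono [of "x / 2 ^ n" 1 F] by linarith
    have "C ^ n = C powr real n" using C by (simp add: powr_realpow)
    also have "\<dots> \<le> C powr (log 2 x + 1)" using n C by (intro powr_mono) auto
    also have "\<dots> = C * C powr (log 2 x)"
      using C by (simp add: powr_add)
    also have "\<dots> = C * x powr log 2 C"
      using C x by (simp add: powr_def log_def mult.commute)
    also have "\<dots> \<le> C * x powr ?K" using C x by (intro mult_left_mono powr_mono) auto
    finally have "C ^ n * t x \<le> C * x powr ?K * t x" by (intro mult_right_mono) auto
    with 1 have "t 1 \<le> C * x powr ?K * t x" by linarith
    then have "t 1 * x powr - ?K / C \<le> (C * x powr ?K * t x) * x powr - ?K / C"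
      using C by (intro divide_right_mono mult_right_mono) auto
    also have "\<dots> = t x * (x powr ?K * x powr - ?K)" using C by (simp add: mult_ac)
    also have "x powr ?K * x powr - ?K = 1" using x by (simp only: powr_add [symmetric]) simp
    finally show ?thesis by (simp add: mult_ac)
  qed
  then show ?thesis using K C tail_pos [of 1] by (intro exI [of _ ?K] conjI exI [of _ "t 1 / C"]) auto
qed

text \<open>The exponent exceeds that of \<open>tail_ge_power\<close> by one; the spare factor
  \<open>1 / x\<close> beats every \<open>\<epsilon>\<close>. This \<open>K\<close> later determines
  the truncation level.\<close>

lemma power_negligible:
  "\<exists>K>0. \<forall>\<epsilon>>0. \<forall>\<^sub>F x in at_top. exp 1 * x powr - K \<le> \<epsilon> * t (m * x)"
proof -
  obtain K c0 where K: "K > 0" "c0 > 0" "\<And>x. x \<ge> 1 \<Longrightarrow> c0 * x powr - K \<le> t x"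
    using tail_ge_power by blast
  have "\<forall>\<^sub>F x in at_top. exp 1 * x powr - (K + 1) \<le> \<epsilon> * t (m * x)" if e: "\<epsilon> > 0" for \<epsilon>
  proof -
    have "((\<lambda>x::real. exp 1 / x) \<longlongrightarrow> 0) at_top" by real_asymp
    moreover have "0 < \<epsilon> * (c0 * m powr - K)" using e K m_pos by simp
    ultimately have "\<forall>\<^sub>F x::real in at_top. exp 1 / x < \<epsilon> * (c0 * m powr - K)"
      by (rule order_tendstoD)
    then show ?thesis using eventually_ge_at_top [of 1]
    proof eventually_elim
      case (elim x)
      have "1 * 1 \<le> m * x" using elim mean_gt by (intro mult_mono) auto
      then have "c0 * (m * x) powr - K \<le> t (m * x)" using K by simp
      then have *: "\<epsilon> * (c0 * (m * x) powr - K) \<le> \<epsilon> * t (m * x)" using e by simp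
      have "exp 1 * x powr - (K + 1) = exp 1 / x * x powr - K"
        using elim by (simp add: powr_diff powr_minus divide_simps powr_add)
      also have "\<dots> \<le> \<epsilon> * (c0 * m powr - K) * x powr - K"
        using elim by (intro mult_right_mono) auto
      also have "\<dots> = \<epsilon> * (c0 * (m * x) powr - K)"
        using elim m_pos by (simp add: powr_mult)
      finally show ?case using * by linarith
    qed
  qed
  moreover have "K + 1 > 0" using K by simp
  ultimately show ?thesis by blast
qed

text \<open>The cap keeps \<open>y powr g\<close> of smaller order than \<open>y\<close> while
  \<open>g > 1 / 2\<close> survives. Insensitivity passes to the smaller shift by monotonicity of
  the tail.\<close>

definition "g = min \<gamma> (3 / 4)"

lemma g_bounds: "1 / 2 < g" "g < 1"
  using gamma by (auto simp: g_def)

lemma tail_plus_power: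
  assumes e: "\<epsilon> > 0"
  shows "\<forall>\<^sub>F x in at_top. (1 - \<epsilon>) * t x \<le> t (x + x powr g)"
proof -
  have "((\<lambda>x. t (x + x powr \<gamma>) / t x) \<longlongrightarrow> 1) at_top"
    using insens tail_pos by (simp add: asymp_equiv_def less_imp_neq [symmetric])
  then have "\<forall>\<^sub>F x in at_top. 1 - \<epsilon> < t (x + x powr \<gamma>) / t x"
    using e by (intro order_tendstoD) auto
  then show ?thesis using eventually_ge_at_top [of 1]
  proof eventually_elim
    case (elim x)
    then have "(1 - \<epsilon>) * t x \<le> t (x + x powr \<gamma>)"
      using tail_pos [of x] by (simp add: pos_less_divide_eq)
    also have "\<dots> \<le> t (x + x powr g)"
      using elim by (intro tail_antimono add_left_mono powr_mono) (auto simp: g_def)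
    finally show ?case .
  qed
qed

lemma powr_g_le: "x \<ge> 1 \<Longrightarrow> x powr g \<le> x"
  using powr_mono [of g 1 x] g_bounds by simp

text \<open>Insensitivity is applied at \<open>y - y powr g / 2\<close>. The halved shift leaves
  this point at or above \<open>y / 2\<close>, and \<open>(y / 2) powr g \<ge> y powr g / 2\<close>,
  so the forward shift from there reaches at least \<open>y\<close>.\<close>

lemma tail_minus_power:
  assumes e: "\<epsilon> > 0"
  shows "\<forall>\<^sub>F y in at_top. t (y - y powr g / 2) \<le> (1 + \<epsilon>) * t y"
proof -
  define e' where "e' = \<epsilon> / (1 + \<epsilon>)"
  have e': "e' > 0" and e'1: "1 - e' = 1 / (1 + \<epsilon>)" using e by (auto simp: e'_def field_simps)
  have lim: "filterlim (\<lambda>y. y - y powr g / 2) at_top at_top"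
  proof (rule filterlim_at_top_mono)
    show "filterlim (\<lambda>y::real. y / 2) at_top at_top" by real_asymp
    show "\<forall>\<^sub>F y in at_top. y / 2 \<le> y - y powr g / 2"
      using eventually_ge_at_top [of 1] by eventually_elim (use powr_g_le in \<open>simp add: field_simps\<close>)
  qed
  have "\<forall>\<^sub>F y in at_top. (1 - e') * t (y - y powr g / 2) \<le> t ((y - y powr g / 2) + (y - y powr g / 2) powr g)"
    using eventually_compose_filterlim [OF tail_plus_power [OF e'] lim] .
  then show ?thesis using eventually_ge_at_top [of 1]
  proof eventually_elim
    case (elim y)
    let ?x = "y - y powr g / 2"
    have x: "y / 2 \<le> ?x" using powr_g_le [of y] elim by (simp add: field_simps)
    have "y powr g / 2 \<le> y powr g / 2 powr g"
      using powr_mono [of g 1 "2::real"] g_bounds elim by (intro divide_left_mono) auto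
    also have "\<dots> = (y / 2) powr g" using elim by (simp add: powr_divide)
    also have "\<dots> \<le> ?x powr g" using x elim g_bounds by (intro powr_mono2) auto
    finally have "t (?x + ?x powr g) \<le> t y" by (intro tail_antimono) auto
    with elim have "t ?x / (1 + \<epsilon>) \<le> t y" unfolding e'1 by simp
    then show ?case using e by (simp add: pos_divide_le_eq mult.commute)
  qed
qed

text \<open>Since \<open>m ^ Suc i * x \<ge> x\<close> for positive \<open>x\<close>, one threshold
  for \<open>x\<close> serves every generation.\<close>

lemma eventually_scale:
  assumes "\<forall>\<^sub>F y in at_top. P (y::real)"
  shows "\<forall>\<^sub>F x in at_top. \<forall>i. P (m ^ Suc i * x)"
proof -
  obtain N where N: "\<And>y. y \<ge> N \<Longrightarrow> P y" using assms by (auto simp: eventually_at_top_linorder)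
  show ?thesis using eventually_ge_at_top [of "max N 1"]
  proof eventually_elim
    case (elim x)
    show ?case
    proof
      fix i
      have "1 * x \<le> m ^ Suc i * x" using elim mean_gt by (intro mult_right_mono one_le_power) auto
      then show "P (m ^ Suc i * x)" using elim by (intro N) linarith
    qed
  qed
qed

section \<open>The single big jump principle\<close>

definition S :: "nat \<Rightarrow> real \<Rightarrow> real" where
  "S n x = (\<Sum>i<n. m ^ i * t (m ^ Suc i * x))"

lemma S_nonneg: "0 \<le> S n x"
  using m_pos by (auto simp: S_def intro!: sum_nonneg)

lemma S_ge: "1 \<le> n \<Longrightarrow> t (m * x) \<le> S n x"
  using m_pos member_le_sum [of 0 "{..<n}" "\<lambda>i. m ^ i * t (m ^ Suc i * x)"] by (auto simp: S_def)

lemma sum_geometric_from: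
  fixes q :: real
  assumes "0 < q" "q < 1"
  shows "(\<Sum>i<n. if k \<le> i then q ^ i else 0) \<le> q ^ k / (1 - q)"
proof -
  \<comment> \<open>The induction runs on the exact value of the partial sum; the branch
    \<open>q ^ k\<close> makes it zero for \<open>n < k\<close>.\<close>
  have "(\<Sum>i<n. if k \<le> i then q ^ i else 0) \<le> (q ^ k - (if k \<le> n then q ^ n else q ^ k)) / (1 - q)"
  proof (induction n)
    case (Suc n)
    then show ?case using assms
      by (auto simp: not_less_eq_eq le_Suc_eq field_simps)
  qed auto
  also have "\<dots> \<le> q ^ k / (1 - q)"
    using assms by (intro divide_right_mono) auto
  finally show ?thesis .
qed

lemma S_le: "\<exists>C\<ge>1. \<forall>x\<ge>1. \<forall>n. S n x \<le> C * t (m * x)"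
proof -
  obtain c' where c': "c' \<ge> 1" "\<And>x i. x \<ge> 1 \<Longrightarrow> m ^ i * t (m ^ Suc i * x) \<le> c' * t (m * x) * r ^ i"
    using tail_geometric by blast
  have "S n x \<le> c' / (1 - r) * t (m * x)" if "x \<ge> 1" for n x
  proof -
    have "S n x \<le> (\<Sum>i<n. c' * t (m * x) * r ^ i)"
      unfolding S_def using that by (intro sum_mono c')
    also have "\<dots> = c' * t (m * x) * (\<Sum>i<n. if 0 \<le> i then r ^ i else 0)"
      by (simp add: sum_distrib_left)
    also have "\<dots> \<le> c' * t (m * x) * (r ^ 0 / (1 - r))"
      using c' r_pos r_less_1 by (intro mult_left_mono sum_geometric_from) auto
    finally show ?thesis by simp
  qed
  moreover have "c' / (1 - r) \<ge> 1" using c' r_pos r_less_1 by (simp add: field_simps)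
  ultimately show ?thesis by blast
qed

text \<open>With \<open>h = y powr g / 2\<close>, failure of later generations to stay low
  contributes order \<open>y powr (1 - 2 * g)\<close>, which vanishes because
  \<open>g > 1 / 2\<close>. The sibling error \<open>m ^ i * y powr - g\<close> vanishes for fixed
  \<open>i\<close> only, so the threshold for \<open>x\<close> depends on \<open>i\<close>.\<close>

lemma one_generation_upper:
  assumes e: "\<epsilon> > 0" and \<eta>: "\<eta> > 0"
  shows "\<forall>\<^sub>F x in at_top. \<forall>n>i. (gw_step F ^^ i) (gw_step_gt F (\<eta> * (m ^ Suc i * x))
     ((gw_step F ^^ (n - Suc i)) (indicator {z. m ^ n * x < real z}))) 1
     \<le> ennreal ((1 + \<epsilon>) * (m ^ i * t (m ^ Suc i * x)))"
proof -
  obtain C where C: "C \<ge> 1" "\<And>x. x > 0 \<Longrightarrow> t (\<eta> * x) \<le> C * t x" using tail_dominated [OF \<eta>] by blast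
  define e where "e = \<epsilon> / 3"
  have e0: "e > 0" using e by (simp add: e_def)
  have "((\<lambda>y. 16 * V * C * y powr (1 - 2 * g)) \<longlongrightarrow> 0) at_top"
    using g_bounds by (intro tendsto_mult_right_zero tendsto_neg_powr filterlim_ident) auto
  then have 1: "\<forall>\<^sub>F y in at_top. 16 * V * C * y powr (1 - 2 * g) < e"
    using e0 by (rule order_tendstoD)
  have "((\<lambda>y. 4 * C * m * ((V + 1) * m ^ i) * y powr - g) \<longlongrightarrow> 0) at_top"
    using g_bounds by (intro tendsto_mult_right_zero tendsto_neg_powr filterlim_ident) auto
  then have 2: "\<forall>\<^sub>F y in at_top. 4 * C * m * ((V + 1) * m ^ i) * y powr - g < e"
    using e0 by (rule order_tendstoD)
  show ?thesis
    using eventually_scale [OF 1] eventually_scale [OF 2] eventually_scale [OF tail_minus_power [OF e0]]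
      eventually_scale [OF eventually_ge_at_top [of 1]]
  proof eventually_elim
    case (elim x)
    define y where "y = m ^ Suc i * x"
    define h where "h = y powr g / 2"
    \<comment> \<open>Chebyshev's bound for a start at most \<open>y - h / 2\<close>; 16 comes from
      squaring \<open>h / 2 = y powr g / 4\<close>.\<close>
    define \<kappa> where "\<kappa> = 16 * V * y powr (1 - 2 * g)"
    note y = elim [rule_format, of i, folded y_def]
    have y2g: "y powr (2 * g) = y powr g * y powr g" by (simp add: powr_add [symmetric])
    have h: "h > 0" "h \<le> y" using y powr_g_le [of y] by (auto simp: h_def)
    have \<kappa>: "\<kappa> \<ge> 0" using V_nonneg by (simp add: \<kappa>_def)
    show ?case
    proof (intro allI impI)
      fix n assume n: "n > i"
      let ?f = "(gw_step F ^^ (n - Suc i)) (indicator {z. m ^ n * x < real z})"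
      have mn: "m ^ n * x = m ^ (n - Suc i) * y"
      proof -
        have "m ^ n = m ^ (n - Suc i) * m ^ Suc i"
          using n by (metis Suc_leI le_add_diff_inverse2 power_add)
        then show ?thesis by (simp add: y_def)
      qed
      have f: "?f w \<le> ennreal \<kappa>" if w: "real w \<le> y - h / 2" for w
      proof -
        have wy: "real w < y" using w h by simp
        have "?f w \<le> ennreal (real w * V / (y - real w)\<^sup>2)"
          unfolding mn using gw_iter_gt_le [OF wy] by simp
        also have "\<dots> \<le> ennreal \<kappa>"
        proof (rule ennreal_leI)
          have "real w * V / (y - real w)\<^sup>2 \<le> y * V / (h / 2)\<^sup>2"
            using w wy h V_nonneg by (intro frac_le mult_mono power_mono) auto
          also have "\<dots> = \<kappa>"
            using y by (simp add: \<kappa>_def h_def power2_eq_square powr_diff y2g)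
          finally show "real w * V / (y - real w)\<^sup>2 \<le> \<kappa>" .
        qed
        finally show ?thesis .
      qed
      have "(gw_step F ^^ i) (gw_step_gt F (\<eta> * y) ?f) 1 \<le> ennreal (\<kappa> * t (\<eta> * y) * m ^ i + t (y - h) * m ^ i
          + 2 / h * (t (\<eta> * y) * m) * ((V + 1) * m ^ (2 * i)))"
        by (rule gw_iter_gt_upper [OF _ f h(1) \<kappa>]) (auto intro!: gw_iter_le_one simp: indicator_def)
      also have "\<dots> \<le> ennreal ((1 + \<epsilon>) * (m ^ i * t y))"
      proof (rule ennreal_leI)
        have ta: "t (\<eta> * y) \<le> C * t y" using C y by simp
        have "\<kappa> * t (\<eta> * y) * m ^ i \<le> \<kappa> * (C * t y) * m ^ i"
          using ta \<kappa> m_pos by (intro mult_left_mono mult_right_mono) auto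
        also have "\<dots> = \<kappa> * C * (t y * m ^ i)" by simp
        also have "\<dots> \<le> e * (t y * m ^ i)"
          using y m_pos by (intro mult_right_mono) (auto simp: \<kappa>_def mult_ac)
        finally have A: "\<kappa> * t (\<eta> * y) * m ^ i \<le> e * (t y * m ^ i)" .
        have "t (y - h) * m ^ i \<le> (1 + e) * t y * m ^ i"
          using y m_pos by (intro mult_right_mono) (auto simp: h_def)
        then have B: "t (y - h) * m ^ i \<le> (1 + e) * (t y * m ^ i)" by simp
        have "2 / h * (t (\<eta> * y) * m) * ((V + 1) * m ^ (2 * i)) \<le> 2 / h * (C * t y * m) * ((V + 1) * m ^ (2 * i))"
          using ta h V_nonneg m_pos by (intro mult_left_mono mult_right_mono) auto
        also have "\<dots> = 4 * C * m * ((V + 1) * m ^ i) * y powr - g * (t y * m ^ i)"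
        proof -
          have "2 / h = 4 * y powr - g" by (simp add: h_def powr_minus_divide)
          moreover have "m ^ (2 * i) = m ^ i * m ^ i" by (simp add: mult_2 power_add)
          ultimately show ?thesis by simp
        qed
        also have "\<dots> \<le> e * (t y * m ^ i)"
          using y m_pos by (intro mult_right_mono) auto
        finally have D: "2 / h * (t (\<eta> * y) * m) * ((V + 1) * m ^ (2 * i)) \<le> e * (t y * m ^ i)" .
        have "(1 + \<epsilon>) * (m ^ i * t y) = e * (t y * m ^ i) + (1 + e) * (t y * m ^ i) + e * (t y * m ^ i)"
          by (simp add: e_def algebra_simps)
        then show "\<kappa> * t (\<eta> * y) * m ^ i + t (y - h) * m ^ i + 2 / h * (t (\<eta> * y) * m) * ((V + 1) * m ^ (2 * i))
            \<le> (1 + \<epsilon>) * (m ^ i * t y)"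
          using A B D by linarith
      qed
      finally show "(gw_step F ^^ i) (gw_step_gt F (\<eta> * (m ^ Suc i * x)) ?f) 1
         \<le> ennreal ((1 + \<epsilon>) * (m ^ i * t (m ^ Suc i * x)))"
        unfolding y_def .
    qed
  qed
qed

lemma gw_upper:
  assumes \<epsilon>: "\<epsilon> > 0"
  shows "\<forall>\<^sub>F x in at_top. \<forall>n\<ge>1. (gw_step F ^^ n) (indicator {z. m ^ n * x < real z}) 1 \<le> ennreal ((1 + \<epsilon>) * S n x)"
proof -
  define e where "e = \<epsilon> / 3"
  have e: "e > 0" using \<epsilon> by (simp add: e_def)
  obtain K where K: "K > 0" "\<And>\<epsilon>. \<epsilon> > 0 \<Longrightarrow> \<forall>\<^sub>F x in at_top. exp 1 * x powr - K \<le> \<epsilon> * t (m * x)"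
    using power_negligible by blast
  \<comment> \<open>This is the level at which \<open>gw_path_le_polynomial\<close> gives decay of
    order \<open>K\<close>. It fixes \<open>C\<close>, and \<open>C\<close> in turn fixes the number
    \<open>k\<close> of early generations.\<close>
  define \<eta> where "\<eta> = 1 / (4 * K)"
  have \<eta>: "\<eta> > 0" using K by (simp add: \<eta>_def)
  obtain C where C: "C \<ge> 1" "\<And>x. x > 0 \<Longrightarrow> t (\<eta> * x) \<le> C * t x" using tail_dominated [OF \<eta>] by blast
  obtain c' where c': "c' \<ge> 1" "\<And>x i. x \<ge> 1 \<Longrightarrow> m ^ i * t (m ^ Suc i * x) \<le> c' * t (m * x) * r ^ i"
    using tail_geometric by blast
  have "(\<lambda>k. C * c' * (r ^ k / (1 - r))) \<longlonglongrightarrow> C * c' * (0 / (1 - r))"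
    using r_pos r_less_1 by (intro tendsto_intros LIMSEQ_power_zero) auto
  then have "\<forall>\<^sub>F k in sequentially. C * c' * (r ^ k / (1 - r)) < e"
    using e by (intro order_tendstoD) auto
  then obtain k where k: "C * c' * (r ^ k / (1 - r)) < e" by (auto simp: eventually_sequentially)
  have "\<forall>\<^sub>F x in at_top. \<forall>i\<in>{..<k}. \<forall>n>i. (gw_step F ^^ i) (gw_step_gt F (\<eta> * (m ^ Suc i * x))
     ((gw_step F ^^ (n - Suc i)) (indicator {z. m ^ n * x < real z}))) 1
     \<le> ennreal ((1 + e) * (m ^ i * t (m ^ Suc i * x)))"
    by (intro eventually_ball_finite ballI one_generation_upper e \<eta>) auto
  then show ?thesis
    using gw_path_le_polynomial [OF K(1)] K(2) [OF e] eventually_ge_at_top [of 1]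
  proof eventually_elim
    case (elim x)
    have small: "(gw_step F ^^ i) (gw_step_gt F (\<eta> * (m ^ Suc i * x))
     ((gw_step F ^^ (n - Suc i)) (indicator {z. m ^ n * x < real z}))) 1
     \<le> ennreal ((1 + e) * (m ^ i * t (m ^ Suc i * x)))" if "i < k" "i < n" for i n
      using elim(1) that by blast
    show ?case
    proof (intro allI impI)
      fix n :: nat assume n: "n \<ge> 1"
      let ?f = "indicator {z. m ^ n * x < real z} :: nat \<Rightarrow> ennreal"
      let ?a = "\<lambda>i. \<eta> * (m ^ Suc i * x)"
      let ?L = "\<lambda>i. if k \<le> i then r ^ i else 0"
      \<comment> \<open>The early and the late bound are added for every \<open>i\<close>, with
        \<open>?L\<close> switching on the late one; thus the first part sums to a multiple of
        \<open>S n x\<close>.\<close>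
      let ?B = "\<lambda>i. (1 + e) * (m ^ i * t (m ^ Suc i * x)) + C * c' * t (m * x) * ?L i"
      have B: "gw_path_le F ?a i (gw_step_gt F (?a i) ((gw_step F ^^ (n - Suc i)) ?f)) 1 \<le> ennreal (?B i)"
        if i: "i < n" for i
      proof -
        let ?G = "gw_step_gt F (?a i) ((gw_step F ^^ (n - Suc i)) ?f)"
        have "gw_path_le F ?a i ?G 1 \<le> (gw_step F ^^ i) ?G 1" by (rule gw_path_le_le_iter)
        also have "\<dots> \<le> ennreal (?B i)"
        proof (cases "i < k")
          case True
          then show ?thesis using small [OF True i] by simp
        next
          case False
          \<comment> \<open>In a late generation the mere occurrence of a jump is rare enough, so
            the success probability afterwards is replaced by 1.\<close>
          have "(gw_step F ^^ i) ?G 1 \<le> (gw_step F ^^ i) (gw_step_gt F (?a i) (\<lambda>_. 1)) 1"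
            by (intro gw_iter_mono gw_step_gt_mono gw_iter_le_one) (auto simp: indicator_def)
          also have "\<dots> \<le> ennreal (t (?a i) * m ^ i)" by (rule gw_iter_gt_one_le)
          also have "\<dots> \<le> ennreal (?B i)"
          proof (rule ennreal_leI)
            have "t (?a i) * m ^ i \<le> C * t (m ^ Suc i * x) * m ^ i"
              using m_pos elim by (intro mult_right_mono C) auto
            also have "\<dots> = C * (m ^ i * t (m ^ Suc i * x))" by simp
            also have "\<dots> \<le> C * (c' * t (m * x) * r ^ i)"
              using C elim by (intro mult_left_mono c') auto
            also have "\<dots> \<le> ?B i" using False e m_pos by (simp add: mult.assoc)
            finally show "t (?a i) * m ^ i \<le> ?B i" .
          qed
          finally show ?thesis .
        qed
        finally show ?thesis .
      qed
      have B0: "?B i \<ge> 0" for i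
        using e C c' m_pos r_pos by (auto intro!: add_nonneg_nonneg mult_nonneg_nonneg)
      have "(gw_step F ^^ n) ?f 1 = gw_path_le F ?a n ?f 1
         + (\<Sum>i<n. gw_path_le F ?a i (gw_step_gt F (?a i) ((gw_step F ^^ (n - Suc i)) ?f)) 1)"
        by (rule gw_iter_decomp)
      also have "\<dots> \<le> ennreal (exp 1 * x powr - K) + (\<Sum>i<n. ennreal (?B i))"
        using elim(2) B unfolding \<eta>_def by (intro add_mono sum_mono) auto
      also have "\<dots> = ennreal (exp 1 * x powr - K + (\<Sum>i<n. ?B i))"
        using B0 by (simp add: sum_nonneg)
      also have "\<dots> \<le> ennreal ((1 + \<epsilon>) * S n x)"
      proof (rule ennreal_leI)
        have "(\<Sum>i<n. ?B i) = (1 + e) * S n x + C * c' * t (m * x) * (\<Sum>i<n. ?L i)"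
          by (simp add: S_def sum.distrib sum_distrib_left)
        also have "\<dots> \<le> (1 + e) * S n x + C * c' * t (m * x) * (r ^ k / (1 - r))"
          using C c' r_pos r_less_1 by (intro add_left_mono mult_left_mono sum_geometric_from) auto
        also have "C * c' * t (m * x) * (r ^ k / (1 - r)) = C * c' * (r ^ k / (1 - r)) * t (m * x)" by simp
        also have "\<dots> \<le> e * t (m * x)" using k by (intro mult_right_mono) auto
        finally have "exp 1 * x powr - K + (\<Sum>i<n. ?B i) \<le> e * t (m * x) + ((1 + e) * S n x + e * t (m * x))"
          using elim by linarith
        also have "\<dots> \<le> e * S n x + ((1 + e) * S n x + e * S n x)"
          using e S_ge [OF n] by (intro add_mono mult_left_mono) auto
        also have "\<dots> = (1 + \<epsilon>) * S n x" by (simp add: e_def algebra_simps)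
        finally show "exp 1 * x powr - K + (\<Sum>i<n. ?B i) \<le> (1 + \<epsilon>) * S n x" .
      qed
      finally show "(gw_step F ^^ n) ?f 1 \<le> ennreal ((1 + \<epsilon>) * S n x)" .
    qed
  qed
qed

end

text \<open>A weighted arithmetic-geometric mean inequality. It trades a first moment for a second
  moment and a mass, both on early-jump paths and for the increments of \<open>W_n\<close>.\<close>

lemma le_square_trade_off:
  fixes s M z :: real
  assumes "s > 0" "M > 0" "z \<ge> 0"
  shows "z \<le> s / M * z\<^sup>2 + M / s"
proof -
  have "0 \<le> (s * z - M)\<^sup>2 + s * M * z" using assms by simp
  then show ?thesis using assms by (simp add: field_simps power2_eq_square)
qed

section \<open>Lower bound for finitely many generations\<close>

context heavy_offspring
begin

lemma path_jump_le:
  "(\<Sum>k<i. gw_path_le F a k (gw_step_gt F (a k) ((gw_step F ^^ (i - Suc k)) (\<lambda>_. 1))) 1)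
    \<le> ennreal (\<Sum>k<i. m ^ k * t (a k))"
proof -
  have "gw_path_le F a k (gw_step_gt F (a k) ((gw_step F ^^ (i - Suc k)) (\<lambda>_. 1))) 1
     \<le> ennreal (m ^ k * t (a k))" for k
    using order_trans [OF gw_path_le_le_iter gw_iter_gt_one_le]
    by (simp add: gw_iter_one mult.commute)
  then have "(\<Sum>k<i. gw_path_le F a k (gw_step_gt F (a k) ((gw_step F ^^ (i - Suc k)) (\<lambda>_. 1))) 1)
    \<le> (\<Sum>k<i. ennreal (m ^ k * t (a k)))"
    by (intro sum_mono)
  also have "\<dots> = ennreal (\<Sum>k<i. m ^ k * t (a k))"
    using m_pos by (intro sum_ennreal) auto
  finally show ?thesis .
qed

text \<open>The mass that the first moment loses on the event of an early big jump is controlled by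
  \<open>z \<le> s * z\<^sup>2 / m ^ i + m ^ i / s\<close>.\<close>

lemma gw_path_le_mean_ge:
  assumes s: "s > 0"
  shows "ennreal (m ^ i) \<le> gw_path_le F a i (\<lambda>z. ennreal (real z)) 1
     + ennreal (m ^ i * (s * (V + 1) + (\<Sum>k<i. m ^ k * t (a k)) / s))"
proof -
  \<comment> \<open>The part of the expectation of \<open>f\<close> at generation \<open>i\<close>
    carried by paths with a jump before that generation, as in
    \<open>gw_iter_decomp\<close>.\<close>
  define Bad where "Bad f = (\<Sum>k<i. gw_path_le F a k (gw_step_gt F (a k) ((gw_step F ^^ (i - Suc k)) f)) 1)" for f
  have Bad_mono: "(\<And>z. f z \<le> f' z) \<Longrightarrow> Bad f \<le> Bad f'" for f f'
    unfolding Bad_def by (intro sum_mono gw_path_le_mono gw_step_gt_mono gw_iter_mono)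
  have Bad_linear: "Bad (\<lambda>z. p * f z + q * f' z) = p * Bad f + q * Bad f'" for p q f f'
  proof -
    have "gw_step_gt F b ((gw_step F ^^ n) (\<lambda>z. p * f z + q * f' z))
       = (\<lambda>z. p * gw_step_gt F b ((gw_step F ^^ n) f) z + q * gw_step_gt F b ((gw_step F ^^ n) f') z)" for b n
      unfolding gw_iter_linear by (rule ext) (rule gw_step_gt_linear)
    then show ?thesis
      unfolding Bad_def by (simp only: gw_path_le_linear) (simp add: sum.distrib sum_distrib_left)
  qed
  have mi: "m ^ i > 0" using m_pos by simp
  have "Bad (\<lambda>z. ennreal (real z))
     \<le> Bad (\<lambda>z. ennreal (s / m ^ i) * ennreal ((real z)\<^sup>2) + ennreal (m ^ i / s) * 1)"
  proof (rule Bad_mono)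
    fix z
    have "real z \<le> s / m ^ i * (real z)\<^sup>2 + m ^ i / s"
      using s mi by (intro le_square_trade_off) auto
    then have "ennreal (real z) \<le> ennreal (s / m ^ i * (real z)\<^sup>2 + m ^ i / s)" by (rule ennreal_leI)
    also have "\<dots> = ennreal (s / m ^ i) * ennreal ((real z)\<^sup>2) + ennreal (m ^ i / s) * 1"
      using s mi by (simp add: ennreal_mult' [symmetric])
    finally show "ennreal (real z) \<le> ennreal (s / m ^ i) * ennreal ((real z)\<^sup>2) + ennreal (m ^ i / s) * 1" .
  qed
  also have "\<dots> = ennreal (s / m ^ i) * Bad (\<lambda>z. ennreal ((real z)\<^sup>2)) + ennreal (m ^ i / s) * Bad (\<lambda>_. 1)"
    by (rule Bad_linear)
  also have "\<dots> \<le> ennreal (s / m ^ i) * ennreal ((V + 1) * m ^ (2 * i))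
      + ennreal (m ^ i / s) * ennreal (\<Sum>k<i. m ^ k * t (a k))"
  proof (intro add_mono mult_left_mono)
    have "Bad (\<lambda>z. ennreal ((real z)\<^sup>2)) \<le> (gw_step F ^^ i) (\<lambda>z. ennreal ((real z)\<^sup>2)) 1"
      unfolding Bad_def using gw_iter_decomp [of i F _ 1 a] by simp
    also have "\<dots> \<le> ennreal ((V + 1) * m ^ (2 * i))" by (rule gw_iter_square_one_le)
    finally show "Bad (\<lambda>z. ennreal ((real z)\<^sup>2)) \<le> ennreal ((V + 1) * m ^ (2 * i))" .
    show "Bad (\<lambda>_. 1) \<le> ennreal (\<Sum>k<i. m ^ k * t (a k))"
      unfolding Bad_def by (rule path_jump_le)
  qed auto
  also have "\<dots> = ennreal (m ^ i * (s * (V + 1) + (\<Sum>k<i. m ^ k * t (a k)) / s))"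
  proof -
    have sn: "(\<Sum>k<i. m ^ k * t (a k)) \<ge> 0" using m_pos by (auto intro: sum_nonneg)
    have "m ^ (2 * i) = m ^ i * m ^ i" by (simp add: mult_2 power_add)
    then have 1: "s / m ^ i * ((V + 1) * m ^ (2 * i)) = m ^ i * (s * (V + 1))" using mi by simp
    have 2: "m ^ i / s * (\<Sum>k<i. m ^ k * t (a k)) = m ^ i * ((\<Sum>k<i. m ^ k * t (a k)) / s)" by simp
    have "ennreal (s / m ^ i) * ennreal ((V + 1) * m ^ (2 * i)) = ennreal (m ^ i * (s * (V + 1)))"
      unfolding 1 [symmetric] using s m_pos by (intro ennreal_mult' [symmetric]) simp
    moreover have "ennreal (m ^ i / s) * ennreal (\<Sum>k<i. m ^ k * t (a k)) = ennreal (m ^ i * ((\<Sum>k<i. m ^ k * t (a k)) / s))"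
      unfolding 2 [symmetric] using s m_pos by (intro ennreal_mult' [symmetric]) simp
    ultimately show ?thesis
      using s mi sn V_nonneg by (simp add: distrib_left)
  qed
  finally have "Bad (\<lambda>z. ennreal (real z)) \<le> ennreal (m ^ i * (s * (V + 1) + (\<Sum>k<i. m ^ k * t (a k)) / s))" .
  moreover have "ennreal (m ^ i) = gw_path_le F a i (\<lambda>z. ennreal (real z)) 1 + Bad (\<lambda>z. ennreal (real z))"
    using gw_iter_decomp [of i F "\<lambda>z. ennreal (real z)" 1 a] gw_iter_real [of i 1] by (simp add: Bad_def)
  ultimately show ?thesis by (simp add: add_left_mono)
qed

text \<open>The three losses \<open>e\<close> are the failure of later generations, the Bonferroni
  term for several jumps in the same generation, and the part of the mean lost to earlier
  jumps.\<close>

lemma gw_path_gt_lower: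
  assumes e: "0 < e" "e < 1 / 3"
    and g: "\<And>w. b < real w \<Longrightarrow> 1 \<le> f w + ennreal e"
    and mean: "ennreal (m ^ i) \<le> gw_path_le F a i (\<lambda>z. ennreal (real z)) 1 + ennreal (e * m ^ i)"
    and small: "(V + 1) * (m ^ i * t b) \<le> e"
  shows "ennreal ((1 - 3 * e) * (m ^ i * t b)) \<le> gw_path_le F a i (gw_step_gt F b f) 1"
proof -
  let ?P = "gw_path_le F a i"
  have "ennreal (1 - e) * (ennreal (t b) * ennreal (real z))
     \<le> gw_step_gt F b f z + ennreal ((t b)\<^sup>2) * ennreal ((real z)\<^sup>2)" for z
  proof -
    have sub: "ennreal (1 - e) \<le> f w" if "b < real w" for w
      using g [OF that] e by (simp add: ennreal_minus [symmetric] ennreal_minus_le_iff add.commute)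
    have "gw_step_gt F b (\<lambda>w. ennreal (1 - e) * 1) z \<le> gw_step_gt F b f z"
      unfolding gw_step_gt_def
    proof (intro nn_integral_mono)
      fix xs
      show "ennreal (1 - e) * 1 * indicator {xs. \<exists>k\<in>set xs. b < real k} xs
         \<le> f (sum_list xs) * indicator {xs. \<exists>k\<in>set xs. b < real k} xs"
      proof (cases "\<exists>k\<in>set xs. b < real k")
        case True
        then obtain k where k: "k \<in> set xs" "b < real k" by auto
        then have "b < real (sum_list xs)" using member_le_sum_list [of k xs] by linarith
        then show ?thesis using sub by (intro mult_right_mono) auto
      qed auto
    qed
    then have "ennreal (1 - e) * gw_step_gt F b (\<lambda>_. 1) z \<le> gw_step_gt F b f z"
      unfolding gw_step_gt_cmult .
    moreover have "ennreal (1 - e) * (ennreal (t b) * ennreal (real z))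
       \<le> ennreal (1 - e) * (gw_step_gt F b (\<lambda>_. 1) z + ennreal ((t b)\<^sup>2) * ennreal ((real z)\<^sup>2))"
      using gw_step_gt_one_ge [of F b z]
      by (intro mult_left_mono) (auto simp: ennreal_of_nat_eq_real_of_nat)
    moreover have "ennreal (1 - e) * (ennreal ((t b)\<^sup>2) * ennreal ((real z)\<^sup>2)) \<le> 1 * (ennreal ((t b)\<^sup>2) * ennreal ((real z)\<^sup>2))"
      using e by (intro mult_right_mono) auto
    ultimately show ?thesis
      unfolding distrib_left mult_1_left by (meson add_mono order_trans)
  qed
  then have "?P (\<lambda>z. ennreal (1 - e) * (ennreal (t b) * ennreal (real z))) 1
     \<le> ?P (\<lambda>z. gw_step_gt F b f z + ennreal ((t b)\<^sup>2) * ennreal ((real z)\<^sup>2)) 1"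
    by (rule gw_path_le_mono)
  also have "\<dots> = ?P (gw_step_gt F b f) 1 + ennreal ((t b)\<^sup>2) * ?P (\<lambda>z. ennreal ((real z)\<^sup>2)) 1"
    using gw_path_le_linear [of F a i 1 "gw_step_gt F b f" "ennreal ((t b)\<^sup>2)"] by simp
  also have "\<dots> \<le> ?P (gw_step_gt F b f) 1 + ennreal ((t b)\<^sup>2) * ennreal ((V + 1) * m ^ (2 * i))"
    by (intro add_left_mono mult_left_mono order_trans [OF gw_path_le_le_iter gw_iter_square_one_le]) auto
  also have "\<dots> \<le> ?P (gw_step_gt F b f) 1 + ennreal (e * (m ^ i * t b))"
  proof -
    have "(t b)\<^sup>2 * ((V + 1) * m ^ (2 * i)) = (V + 1) * (m ^ i * t b) * (m ^ i * t b)"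
      by (simp add: power2_eq_square mult_2 power_add)
    also have "\<dots> \<le> e * (m ^ i * t b)" using small m_pos by (intro mult_right_mono) auto
    finally show ?thesis by (simp add: ennreal_mult' [symmetric] ennreal_leI add_left_mono)
  qed
  finally have 1: "ennreal ((1 - e) * t b) * ?P (\<lambda>z. ennreal (real z)) 1
     \<le> ?P (gw_step_gt F b f) 1 + ennreal (e * (m ^ i * t b))"
    using e unfolding gw_path_le_cmult by (simp add: ennreal_mult mult.assoc)
  have "ennreal ((1 - e) * t b * m ^ i) = ennreal ((1 - e) * t b) * ennreal (m ^ i)"
    using e by (intro ennreal_mult') auto
  also have "\<dots> \<le> ennreal ((1 - e) * t b) * (?P (\<lambda>z. ennreal (real z)) 1 + ennreal (e * m ^ i))"
    by (intro mult_left_mono mean) auto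
  also have "\<dots> \<le> ?P (gw_step_gt F b f) 1 + ennreal (e * (m ^ i * t b)) + ennreal (e * (m ^ i * t b))"
  proof -
    have "(1 - e) * t b * (e * m ^ i) \<le> 1 * t b * (e * m ^ i)"
      using e m_pos by (intro mult_right_mono) auto
    then have "ennreal ((1 - e) * t b) * ennreal (e * m ^ i) \<le> ennreal (e * (m ^ i * t b))"
      by (subst ennreal_mult' [symmetric]) (use e in \<open>simp_all add: ennreal_leI mult_ac\<close>)
    then show ?thesis unfolding distrib_left by (intro add_mono 1)
  qed
  also have "\<dots> = ?P (gw_step_gt F b f) 1 + ennreal (2 * e * (m ^ i * t b))"
    using e m_pos by (simp add: add.assoc ennreal_plus [symmetric] del: ennreal_plus)
  finally have "ennreal ((1 - e) * t b * m ^ i) - ennreal (2 * e * (m ^ i * t b)) \<le> ?P (gw_step_gt F b f) 1"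
    by (simp add: ennreal_minus_le_iff add.commute)
  then show ?thesis
    using e m_pos by (simp add: ennreal_minus algebra_simps)
qed

lemma gw_lower:
  assumes \<epsilon>: "\<epsilon> > 0"
  shows "\<forall>\<^sub>F x in at_top. \<forall>n. ennreal ((1 - \<epsilon>) * S n x) \<le> (gw_step F ^^ n) (indicator {z. m ^ n * x < real z}) 1"
proof -
  \<comment> \<open>A quarter, because to the three losses in \<open>gw_path_gt_lower\<close> comes
    a fourth for replacing \<open>t (a i)\<close> by \<open>t (y i)\<close>.\<close>
  define e where "e = min \<epsilon> 1 / 4"
  have e: "0 < e" "e < 1 / 3" "4 * e \<le> \<epsilon>" "4 * e \<le> 1" using \<epsilon> by (auto simp: e_def)
  \<comment> \<open>The second moment part of \<open>gw_path_le_mean_ge\<close> then costs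
    \<open>e / 2\<close>; the other half is left for the jump probabilities divided by
    \<open>s\<close>, which are small for large \<open>x\<close>.\<close>
  define s where "s = e / (2 * (V + 1))"
  have "V + 1 > 0" using V_nonneg by simp
  then have s: "s > 0" "s * (V + 1) = e / 2"
    using e(1) unfolding s_def by (simp_all only: divide_pos_pos mult_pos_pos zero_less_numeral) (simp add: field_simps)
  obtain C where C: "C \<ge> 1" "\<And>x n. x \<ge> 1 \<Longrightarrow> S n x \<le> C * t (m * x)" using S_le by blast
  obtain c' where c': "c' \<ge> 1" "\<And>x i. x \<ge> 1 \<Longrightarrow> m ^ i * t (m ^ Suc i * x) \<le> c' * t (m * x) * r ^ i"
    using tail_geometric by blast
  have "((\<lambda>y. V * y powr (1 - 2 * g) + V * y powr - g) \<longlongrightarrow> 0) at_top"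
    using g_bounds by (intro tendsto_add_zero tendsto_mult_right_zero tendsto_neg_powr filterlim_ident) auto
  then have 1: "\<forall>\<^sub>F y in at_top. V * y powr (1 - 2 * g) + V * y powr - g < e"
    using e(1) by (rule order_tendstoD)
  have tail0: "(t \<longlongrightarrow> 0) at_top"
  proof (rule tendsto_sandwich [where f = "\<lambda>_. 0" and h = "\<lambda>x. c * t 2 * (x / 2) powr - (1 + \<delta>)"])
    show "\<forall>\<^sub>F x in at_top. t x \<le> c * t 2 * (x / 2) powr - (1 + \<delta>)"
      using eventually_gt_at_top [of 2]
    proof eventually_elim
      case (elim x)
      then show ?case using bound [of 2 "x / 2"] unfolding powr_minus_divide by simp
    qed
    have "((\<lambda>x. (x / 2) powr - (1 + \<delta>)) \<longlongrightarrow> 0) at_top"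
    proof (rule tendsto_neg_powr)
      show "filterlim (\<lambda>x::real. x / 2) at_top at_top" by real_asymp
    qed (use delta_pos in auto)
    then show "((\<lambda>x. c * t 2 * (x / 2) powr - (1 + \<delta>)) \<longlongrightarrow> 0) at_top"
      by (rule tendsto_mult_right_zero)
  qed auto
  have lim: "filterlim (\<lambda>x. m * x) at_top at_top"
    using m_pos by (intro filterlim_tendsto_pos_mult_at_top [OF tendsto_const] filterlim_ident) auto
  have tm0: "((\<lambda>x. t (m * x)) \<longlongrightarrow> 0) at_top"
    by (rule filterlim_compose [OF tail0 lim])
  have 2: "\<forall>\<^sub>F x in at_top. t (m * x) < e / ((V + 1) * c')"
  proof (rule order_tendstoD [OF tm0])
    show "0 < e / ((V + 1) * c')" using e(1) c'(1) V_nonneg by simp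
  qed
  have 3: "\<forall>\<^sub>F x in at_top. t (m * x) < e * s / (2 * C)"
  proof (rule order_tendstoD [OF tm0])
    show "0 < e * s / (2 * C)" using e(1) C(1) s(1) by simp
  qed
  show ?thesis
    using eventually_scale [OF 1] 2 3 eventually_scale [OF tail_plus_power [OF e(1)]]
      eventually_scale [OF eventually_ge_at_top [of 1]] eventually_ge_at_top [of 1]
  proof eventually_elim
    case (elim x)
    define y where "y i = m ^ Suc i * x" for i
    define a where "a i = y i + y i powr g" for i
    have y1: "y i \<ge> 1" for i using elim(5) by (simp add: y_def)
    have ay: "t (a i) \<le> t (y i)" for i using y1 [of i] by (intro tail_antimono) (auto simp: a_def)
    have sum_le: "(\<Sum>k<i. m ^ k * t (a k)) \<le> S i x" for i
      unfolding S_def using ay m_pos by (intro sum_mono mult_left_mono) (auto simp: y_def)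
    show ?case
    proof
      fix n
      let ?f = "indicator {z. m ^ n * x < real z} :: nat \<Rightarrow> ennreal"
      have "ennreal ((1 - 4 * e) * (m ^ i * t (y i)))
         \<le> gw_path_le F a i (gw_step_gt F (a i) ((gw_step F ^^ (n - Suc i)) ?f)) 1" if i: "i < n" for i
      proof -
        have "(1 - 4 * e) * t (y i) \<le> (1 - 3 * e) * ((1 - e) * t (y i))"
        proof -
          have "1 - 4 * e \<le> (1 - 3 * e) * (1 - e)" by (simp add: algebra_simps)
          then have "(1 - 4 * e) * t (y i) \<le> (1 - 3 * e) * (1 - e) * t (y i)"
            by (rule mult_right_mono) simp
          then show ?thesis by (simp only: mult.assoc)
        qed
        also have "\<dots> \<le> (1 - 3 * e) * t (a i)"
          using elim(4) e by (intro mult_left_mono) (auto simp: a_def y_def)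
        finally have "m ^ i * ((1 - 4 * e) * t (y i)) \<le> m ^ i * ((1 - 3 * e) * t (a i))"
          using m_pos by (intro mult_left_mono) auto
        then have "ennreal ((1 - 4 * e) * (m ^ i * t (y i))) \<le> ennreal ((1 - 3 * e) * (m ^ i * t (a i)))"
          by (intro ennreal_leI) (simp add: mult_ac)
        also have "\<dots> \<le> gw_path_le F a i (gw_step_gt F (a i) ((gw_step F ^^ (n - Suc i)) ?f)) 1"
        proof (rule gw_path_gt_lower [OF e(1,2)])
          fix w :: nat assume w: "a i < real w"
          have mn: "m ^ n * x = m ^ (n - Suc i) * y i"
          proof -
            have "m ^ n = m ^ (n - Suc i) * m ^ Suc i"
              using i by (metis Suc_leI le_add_diff_inverse2 power_add)
            then show ?thesis by (simp add: y_def)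
          qed
          have wy: "y i < real w" using w y1 [of i] by (simp add: a_def) (smt (verit) powr_ge_zero)
          have "1 \<le> (gw_step F ^^ (n - Suc i)) ?f w + ennreal (real w * V / (real w - y i)\<^sup>2)"
            unfolding mn by (rule gw_iter_gt_ge [OF wy])
          also have "\<dots> \<le> (gw_step F ^^ (n - Suc i)) ?f w + ennreal e"
          proof (intro add_left_mono ennreal_leI)
            define v where "v = real w - y i"
            define h where "h = y i powr g"
            have h: "0 < h" "h \<le> v" using y1 [of i] w by (auto simp: h_def v_def a_def)
            have v: "0 < v" using h by simp
            have y2g: "y i powr (2 * g) = h * h" by (simp add: h_def powr_add [symmetric])
            \<comment> \<open>The size \<open>w\<close> is unbounded, so it is split at
              \<open>y i\<close>: both resulting terms decrease in the excess \<open>v\<close>,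
              which is at least \<open>h\<close>.\<close>
            have "real w = y i + v" by (simp add: v_def)
            then have "real w * V / (real w - y i)\<^sup>2 = V * (y i / v\<^sup>2) + V * (1 / v)"
              using v by (simp add: field_simps power2_eq_square)
            also have "\<dots> \<le> V * (y i / h\<^sup>2) + V * (1 / h)"
              using h v y1 [of i] V_nonneg
              by (intro add_mono mult_left_mono divide_left_mono power_mono mult_pos_pos) auto
            also have "\<dots> = V * y i powr (1 - 2 * g) + V * y i powr - g"
            proof -
              have "y i powr (1 - 2 * g) = y i / h\<^sup>2"
                using y1 [of i] by (simp add: powr_diff y2g power2_eq_square)
              moreover have "y i powr - g = 1 / h" by (simp add: h_def powr_minus_divide)
              ultimately show ?thesis by simp
            qed
            also have "\<dots> \<le> e" using elim(1) by (simp add: y_def less_imp_le)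
            finally show "real w * V / (real w - y i)\<^sup>2 \<le> e" .
          qed
          finally show "1 \<le> (gw_step F ^^ (n - Suc i)) ?f w + ennreal e" .
        next
          have "(\<Sum>k<i. m ^ k * t (a k)) \<le> e * s / 2"
          proof -
            have "C * t (m * x) \<le> C * (e * s / (2 * C))"
              using elim(3) C(1) by (intro mult_left_mono) auto
            also have "\<dots> = e * s / 2" using C(1) by simp
            finally show ?thesis using sum_le [of i] C(2) [OF elim(6), of i] by linarith
          qed
          then have "s * (V + 1) + (\<Sum>k<i. m ^ k * t (a k)) / s \<le> e"
            unfolding s(2) using s(1) by (simp add: field_simps)
          then have "m ^ i * (s * (V + 1) + (\<Sum>k<i. m ^ k * t (a k)) / s) \<le> m ^ i * e"
            using m_pos by (intro mult_left_mono) auto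
          then have "ennreal (m ^ i * (s * (V + 1) + (\<Sum>k<i. m ^ k * t (a k)) / s)) \<le> ennreal (e * m ^ i)"
            by (intro ennreal_leI) (simp only: mult.commute [of e])
          then show "ennreal (m ^ i) \<le> gw_path_le F a i (\<lambda>z. ennreal (real z)) 1 + ennreal (e * m ^ i)"
            by (rule order_trans [OF gw_path_le_mean_ge [OF s(1)] add_left_mono])
        next
          have "m ^ i * t (a i) \<le> m ^ i * t (y i)" using ay m_pos by (intro mult_left_mono) auto
          also have "\<dots> \<le> c' * t (m * x) * r ^ i" unfolding y_def using elim(6) by (rule c')
          also have "\<dots> \<le> c' * t (m * x) * 1"
            using c'(1) r_pos r_less_1 by (intro mult_left_mono power_le_one) auto
          finally have "(V + 1) * (m ^ i * t (a i)) \<le> (V + 1) * (c' * t (m * x))"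
            using V_nonneg by (intro mult_left_mono) auto
          also have "\<dots> \<le> e"
          proof -
            have "0 < (V + 1) * c'" using V_nonneg c'(1) by simp
            then have "t (m * x) * ((V + 1) * c') < e" using elim(2) by (simp only: pos_less_divide_eq)
            then show ?thesis by (simp add: mult_ac)
          qed
          finally show "(V + 1) * (m ^ i * t (a i)) \<le> e" .
        qed
        finally show ?thesis .
      qed
      then have "(\<Sum>i<n. ennreal ((1 - 4 * e) * (m ^ i * t (y i))))
         \<le> (\<Sum>i<n. gw_path_le F a i (gw_step_gt F (a i) ((gw_step F ^^ (n - Suc i)) ?f)) 1)"
        by (intro sum_mono) auto
      also have "\<dots> \<le> (gw_step F ^^ n) ?f 1"
        using gw_iter_decomp [of n F ?f 1 a] by simp
      finally have "ennreal (\<Sum>i<n. (1 - 4 * e) * (m ^ i * t (y i))) \<le> (gw_step F ^^ n) ?f 1"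
        using e(4) m_pos by (subst sum_ennreal [symmetric]) auto
      moreover have "(1 - \<epsilon>) * S n x \<le> (\<Sum>i<n. (1 - 4 * e) * (m ^ i * t (y i)))"
      proof -
        have "(1 - \<epsilon>) * S n x \<le> (1 - 4 * e) * S n x"
          using e(3) S_nonneg by (intro mult_right_mono) auto
        then show ?thesis by (simp only: S_def y_def sum_distrib_left)
      qed
      ultimately show "ennreal ((1 - \<epsilon>) * S n x) \<le> (gw_step F ^^ n) ?f 1"
        by (meson ennreal_leI order_trans)
    qed
  qed
qed

section \<open>Asymptotics along the generations\<close>

lemma gw_asymp:
  assumes "\<epsilon> > 0"
  shows "\<forall>\<^sub>F x in at_top. \<forall>n\<ge>1. \<forall>p\<ge>0.
    ennreal p = (gw_step F ^^ n) (indicator {z. m ^ n * x < real z}) 1 \<longrightarrow> \<bar>p - S n x\<bar> \<le> \<epsilon> * S n x"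
  using gw_upper [OF assms] gw_lower [OF assms]
proof eventually_elim
  case (elim x)
  show ?case
  proof (intro allI impI)
    fix n :: nat and p :: real
    assume n: "1 \<le> n" and p: "0 \<le> p"
      and eq: "ennreal p = (gw_step F ^^ n) (indicator {z. m ^ n * x < real z}) 1"
    have "ennreal p \<le> ennreal ((1 + \<epsilon>) * S n x)" using elim(1) n eq by simp
    moreover have "0 \<le> (1 + \<epsilon>) * S n x" using assms S_nonneg by simp
    ultimately have 1: "p \<le> (1 + \<epsilon>) * S n x" by (simp add: ennreal_le_iff)
    have "ennreal ((1 - \<epsilon>) * S n x) \<le> ennreal p" using elim(2) eq by simp
    then have "(1 - \<epsilon>) * S n x \<le> p" using p by (simp add: ennreal_le_iff)
    with 1 show "\<bar>p - S n x\<bar> \<le> \<epsilon> * S n x" by (simp add: algebra_simps abs_le_iff)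
  qed
qed

definition S_inf :: "real \<Rightarrow> real" where
  "S_inf x = (\<Sum>i. m ^ i * t (m ^ Suc i * x))"

lemma S_sums:
  assumes "x \<ge> 1"
  shows "(\<lambda>i. m ^ i * t (m ^ Suc i * x)) sums S_inf x"
proof -
  obtain c' where c': "c' \<ge> 1" "\<And>x i. x \<ge> 1 \<Longrightarrow> m ^ i * t (m ^ Suc i * x) \<le> c' * t (m * x) * r ^ i"
    using tail_geometric by blast
  have "summable (\<lambda>i. m ^ i * t (m ^ Suc i * x))"
  proof (rule summable_comparison_test')
    show "summable (\<lambda>i. c' * t (m * x) * r ^ i)"
      using r_pos r_less_1 by (intro summable_mult summable_geometric) auto
    show "norm (m ^ i * t (m ^ Suc i * x)) \<le> c' * t (m * x) * r ^ i" if "i \<ge> 0" for i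
      using c'(2) [OF assms, of i] m_pos by simp
  qed
  then show ?thesis unfolding S_inf_def by (rule summable_sums)
qed

lemma S_tendsto: "x \<ge> 1 \<Longrightarrow> (\<lambda>n. S n x) \<longlonglongrightarrow> S_inf x"
  using S_sums by (simp add: sums_def S_def)

lemma S_le_S_inf: "x \<ge> 1 \<Longrightarrow> S n x \<le> S_inf x"
  using S_sums [of x] m_pos unfolding S_def S_inf_def
  by (intro sum_le_suminf) (auto simp: sums_iff)

lemma S_inf_pos: "x \<ge> 1 \<Longrightarrow> S_inf x > 0"
  using S_le_S_inf [of x 1] S_ge [of 1 x] tail_pos [of "m * x"] by linarith

text \<open>The remainder is at most a constant times \<open>r ^ n * t (m * x)\<close>, and
  \<open>t (m * x)\<close> is the first term of \<open>S_inf x\<close>; hence \<open>N\<close> is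
  independent of \<open>x\<close>.\<close>

lemma S_inf_minus_S_le:
  assumes e: "\<epsilon> > 0"
  shows "\<exists>N. \<forall>x\<ge>1. \<forall>n\<ge>N. S_inf x - S n x \<le> \<epsilon> * S_inf x"
proof -
  obtain c' where c': "c' \<ge> 1" "\<And>x i. x \<ge> 1 \<Longrightarrow> m ^ i * t (m ^ Suc i * x) \<le> c' * t (m * x) * r ^ i"
    using tail_geometric by blast
  have "(\<lambda>k. c' * (r ^ k / (1 - r))) \<longlonglongrightarrow> c' * (0 / (1 - r))"
    using r_pos r_less_1 by (intro tendsto_intros LIMSEQ_power_zero) auto
  then have "\<forall>\<^sub>F k in sequentially. c' * (r ^ k / (1 - r)) < \<epsilon>"
    using e by (intro order_tendstoD) auto
  then obtain N where N: "\<And>k. k \<ge> N \<Longrightarrow> c' * (r ^ k / (1 - r)) < \<epsilon>" by (auto simp: eventually_sequentially)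
  have "S_inf x - S n x \<le> \<epsilon> * S_inf x" if x: "x \<ge> 1" and n: "n \<ge> N" for x n
  proof -
    have "S k x - S n x \<le> \<epsilon> * S_inf x" for k
    proof -
      have "S k x \<le> S n x + (\<Sum>i<k. if n \<le> i then c' * t (m * x) * r ^ i else 0)"
      proof (induction k)
        case 0 then show ?case using S_nonneg [of n x] by (simp add: S_def)
      next
        case (Suc k)
        show ?case
        proof (cases "n \<le> k")
          case True
          then show ?thesis using Suc c'(2) [OF x, of k] by (simp add: S_def)
        next
          case False
          have "S (Suc k) x \<le> S n x"
            unfolding S_def using False m_pos by (intro sum_mono2) auto
          moreover have "0 \<le> (\<Sum>i<Suc k. if n \<le> i then c' * t (m * x) * r ^ i else 0)"
            using c'(1) r_pos by (intro sum_nonneg) auto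
          ultimately show ?thesis by linarith
        qed
      qed
      also have "(\<Sum>i<k. if n \<le> i then c' * t (m * x) * r ^ i else 0) = c' * t (m * x) * (\<Sum>i<k. if n \<le> i then r ^ i else 0)"
        unfolding sum_distrib_left by (intro sum.cong) auto
      also have "\<dots> \<le> c' * t (m * x) * (r ^ n / (1 - r))"
        using c'(1) r_pos r_less_1 by (intro mult_left_mono sum_geometric_from) auto
      also have "\<dots> = c' * (r ^ n / (1 - r)) * t (m * x)" by simp
      also have "\<dots> \<le> \<epsilon> * S_inf x"
        using N [OF n] e S_le_S_inf [OF x, of 1] S_ge [of 1 x] by (intro mult_mono) auto
      finally show ?thesis by simp
    qed
    then show ?thesis
      using tendsto_diff [OF S_tendsto [OF x] tendsto_const [of "S n x"]] by (meson LIMSEQ_le_const2)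
  qed
  then show ?thesis by blast
qed

text \<open>Offspring numbers are integers, so the tail is a right-continuous step function,
  constant from \<open>M * x\<close> up to the next integer. Finitely many terms share an interval
  of constancy.\<close>

lemma S_right_constant:
  assumes x: "x \<ge> 0"
  shows "\<forall>\<^sub>F x' in at_right x. S n x' = S n x"
proof -
  have "\<forall>\<^sub>F x' in at_right x. t (m ^ Suc i * x') = t (m ^ Suc i * x)" for i
  proof -
    define M where "M = m ^ Suc i"
    have M: "M > 0" using m_pos by (simp add: M_def)
    let ?u = "(real_of_int \<lfloor>M * x\<rfloor> + 1) / M"
    have "x < ?u" using M by (simp add: pos_less_divide_eq mult.commute)
    then have "\<forall>\<^sub>F x' in at_right x. x < x' \<and> x' < ?u"
      using eventually_at_right_less eventually_at_right_field by (auto simp: eventually_at_right_field)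
    then have "\<forall>\<^sub>F x' in at_right x. t (M * x') = t (M * x)"
    proof eventually_elim
      case (elim x')
      then have 1: "M * x < M * x'" and 2: "M * x' < real_of_int \<lfloor>M * x\<rfloor> + 1"
        using M by (auto simp: pos_less_divide_eq mult.commute)
      have "real k > M * x' \<longleftrightarrow> real k > M * x" for k
      proof
        assume "real k > M * x"
        then have "int k > \<lfloor>M * x\<rfloor>" by linarith
        then show "real k > M * x'" using 2 by linarith
      qed (use 1 in linarith)
      then show ?case by (simp add: tail_def)
    qed
    then show ?thesis by (simp add: M_def)
  qed
  then have "\<forall>\<^sub>F x' in at_right x. \<forall>i\<in>{..<n}. t (m ^ Suc i * x') = t (m ^ Suc i * x)"
    by (intro eventually_ball_finite) auto
  then show ?thesis by eventually_elim (simp add: S_def)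
qed

text \<open>Almost sure convergence bounds the probability of \<open>W > x\<close> from below only
  through levels \<open>x' > x\<close>; this lemma lets \<open>x'\<close> decrease to
  \<open>x\<close>. It goes through \<open>S n\<close>, since the intervals of constancy may shrink
  as \<open>n\<close> grows.\<close>

lemma S_inf_right_limit:
  assumes x: "x \<ge> 1" and q: "q \<ge> 0" and p: "\<And>x'. x' > x \<Longrightarrow> q * S_inf x' \<le> p"
  shows "q * S_inf x \<le> p"
proof -
  have "q * S n x \<le> p" for n
  proof -
    have "\<forall>\<^sub>F x' in at_right x. x < x'" by (simp add: eventually_at_right_less)
    with S_right_constant [of x n] x have "\<forall>\<^sub>F x' in at_right x. S n x' = S n x \<and> x < x'"
      by (simp add: eventually_conj_iff)
    then obtain x' where x': "S n x' = S n x" "x < x'"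
      using eventually_happens' [of "at_right x"] trivial_limit_at_right_real by blast
    then have "q * S n x \<le> q * S_inf x'" using S_le_S_inf [of x' n] x q by (simp add: mult_left_mono)
    then show ?thesis using p [OF x'(2)] by linarith
  qed
  then show ?thesis
    using tendsto_mult_left [OF S_tendsto [OF x], of q] by (meson LIMSEQ_le_const2)
qed

end

section \<open>The process on its probability space\<close>

text \<open>The measurable space is arbitrary and only generations below \<open>n\<close> are
  constrained, so that this also applies to the coordinate process on a product over those
  generations.\<close>

lemma GW_Z_measurable:
  assumes "\<And>k i. k < n \<Longrightarrow> X k i \<in> measurable N (count_space UNIV)"
  shows "GW_Z X n \<in> measurable N (count_space UNIV)"
  using assms
proof (induction n)
  case (Suc n)
  have [measurable]: "GW_Z X n \<in> measurable N (count_space UNIV)"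
    by (rule Suc.IH) (simp add: Suc.prems)
  have [measurable]: "X n i \<in> measurable N (count_space UNIV)" for i
    by (simp add: Suc.prems)
  have "(\<lambda>\<omega>. \<Sum>i\<in>{1..GW_Z X n \<omega>}. X n i \<omega>) \<in> measurable N (count_space UNIV)"
    by (rule measurable_compose_countable [where f = "\<lambda>z \<omega>. \<Sum>i\<in>{1..z}. X n i \<omega>"]) measurable
  moreover have "GW_Z X (Suc n) = (\<lambda>\<omega>. \<Sum>i\<in>{1..GW_Z X n \<omega>}. X n i \<omega>)" by (rule ext) simp
  ultimately show ?case by simp
next
  case 0
  have "GW_Z X 0 = (\<lambda>_. 1)" by (rule ext) simp
  then show ?case by simp
qed

lemma GW_Z_cong:
  assumes "\<And>k i. k < n \<Longrightarrow> X k i \<omega> = Y k i \<omega>'"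
  shows "GW_Z X n \<omega> = GW_Z Y n \<omega>'"
  using assms by (induction n) auto

context prob_space
begin

lemma indep_var_nn_integral_nat:
  fixes X Y :: "'a \<Rightarrow> nat" and h :: "nat \<Rightarrow> nat \<Rightarrow> ennreal"
  assumes "indep_var (count_space UNIV) X (count_space UNIV) Y"
  shows "(\<integral>\<^sup>+\<omega>. h (X \<omega>) (Y \<omega>) \<partial>M) = (\<integral>\<^sup>+\<omega>. \<integral>\<^sup>+\<omega>'. h (X \<omega>) (Y \<omega>') \<partial>M \<partial>M)"
proof -
  have [measurable]: "random_variable (count_space UNIV) X" "random_variable (count_space UNIV) Y"
    and eq: "distr M (count_space UNIV) X \<Otimes>\<^sub>M distr M (count_space UNIV) Y
      = distr M (count_space UNIV \<Otimes>\<^sub>M count_space UNIV) (\<lambda>x. (X x, Y x))"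
    using assms by (auto simp: indep_var_distribution_eq)
  have h [measurable]: "case_prod h \<in> borel_measurable (count_space UNIV \<Otimes>\<^sub>M count_space UNIV)"
    by (simp add: pair_measure_countable)
  interpret Y: prob_space "distr M (count_space UNIV) Y" by (rule prob_space_distr) simp
  have "(\<integral>\<^sup>+\<omega>. h (X \<omega>) (Y \<omega>) \<partial>M)
      = (\<integral>\<^sup>+p. case_prod h p \<partial>distr M (count_space UNIV \<Otimes>\<^sub>M count_space UNIV) (\<lambda>x. (X x, Y x)))"
    by (subst nn_integral_distr) auto
  also have "\<dots> = (\<integral>\<^sup>+x. \<integral>\<^sup>+y. h x y \<partial>distr M (count_space UNIV) Y \<partial>distr M (count_space UNIV) X)"
    unfolding eq [symmetric]
    by (subst Y.nn_integral_fst [symmetric]) (auto cong: measurable_cong_sets)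
  also have "\<dots> = (\<integral>\<^sup>+\<omega>. \<integral>\<^sup>+\<omega>'. h (X \<omega>) (Y \<omega>') \<partial>M \<partial>M)"
    by (simp add: nn_integral_distr)
  finally show ?thesis .
qed

text \<open>The open set half of the portmanteau theorem: Fatou's lemma for indicators, as a limit
  in an open set is eventually approached from within it.\<close>

lemma prob_open_le_of_AE_tendsto:
  fixes X :: "nat \<Rightarrow> 'a \<Rightarrow> real"
  assumes [measurable]: "\<And>n. random_variable borel (X n)" "random_variable borel Y"
    and lim: "AE \<omega> in M. (\<lambda>n. X n \<omega>) \<longlonglongrightarrow> Y \<omega>"
    and G: "open G" and le: "\<forall>\<^sub>F n in sequentially. prob {\<omega>\<in>space M. X n \<omega> \<in> G} \<le> u"
  shows "prob {\<omega>\<in>space M. Y \<omega> \<in> G} \<le> u"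
proof -
  have [measurable]: "G \<in> sets borel" using G by simp
  have u: "0 \<le> u"
    using le by (auto simp: eventually_sequentially dest!: spec intro: order_trans [OF measure_nonneg])
  have "ennreal (prob {\<omega>\<in>space M. Y \<omega> \<in> G}) = (\<integral>\<^sup>+\<omega>. indicator {\<omega>\<in>space M. Y \<omega> \<in> G} \<omega> \<partial>M)"
    by (simp add: emeasure_eq_measure)
  also have "\<dots> \<le> (\<integral>\<^sup>+\<omega>. liminf (\<lambda>n. indicator {\<omega>\<in>space M. X n \<omega> \<in> G} \<omega>) \<partial>M)"
  proof (rule nn_integral_mono_AE)
    show "AE \<omega> in M. indicator {\<omega>\<in>space M. Y \<omega> \<in> G} \<omega>
       \<le> liminf (\<lambda>n. indicator {\<omega>\<in>space M. X n \<omega> \<in> G} \<omega> :: ennreal)"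
      using lim AE_space
    proof eventually_elim
      case (elim \<omega>)
      show ?case
      proof (cases "Y \<omega> \<in> G")
        case True
        then have "\<forall>\<^sub>F n in sequentially. X n \<omega> \<in> G" using elim G by (auto intro: topological_tendstoD)
        then have "\<forall>\<^sub>F n in sequentially. (1::ennreal) \<le> indicator {\<omega>\<in>space M. X n \<omega> \<in> G} \<omega>"
          by eventually_elim (use elim in simp)
        then show ?thesis using True elim by (auto intro: Liminf_bounded)
      qed simp
    qed
  qed
  also have "\<dots> \<le> liminf (\<lambda>n. \<integral>\<^sup>+\<omega>. indicator {\<omega>\<in>space M. X n \<omega> \<in> G} \<omega> \<partial>M)"
    by (rule nn_integral_liminf) measurable
  also have "\<dots> \<le> ennreal u"
  proof (rule Liminf_le)
    show "\<forall>\<^sub>F n in sequentially. (\<integral>\<^sup>+\<omega>. indicator {\<omega>\<in>space M. X n \<omega> \<in> G} \<omega> \<partial>M) \<le> ennreal u"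
      using le by eventually_elim (simp add: emeasure_eq_measure ennreal_leI)
  qed simp
  finally show ?thesis using u by (simp add: ennreal_le_iff)
qed

end

section \<open>Laws of generation sizes as iterates of the transition operator\<close>

locale gw_process = prob_space M for M :: "'a measure" +
  fixes xi :: "nat \<Rightarrow> nat \<Rightarrow> 'a \<Rightarrow> nat" and F :: "nat pmf"
  assumes indep: "indep_vars (\<lambda>_. count_space UNIV) (\<lambda>(n, i). xi n i) UNIV"
    and distr: "\<And>n i. distr M (count_space UNIV) (xi n i) = measure_pmf F"
begin

abbreviation "\<Xi> \<equiv> \<lambda>p. case p of (n, i) \<Rightarrow> xi n i"

lemma xi_measurable [measurable]: "xi n i \<in> measurable M (count_space UNIV)"
  using indep by (force simp: indep_vars_def)

lemma Z_measurable [measurable]: "GW_Z xi n \<in> measurable M (count_space UNIV)"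
  by (rule GW_Z_measurable) simp

lemma nn_integral_xi: "(\<integral>\<^sup>+\<omega>. f (xi n i \<omega>) \<partial>M) = (\<integral>\<^sup>+k. f k \<partial>F)"
  by (subst distr [of n i, symmetric]) (simp add: nn_integral_distr)

lemma indep_next_sum:
  "indep_var (count_space UNIV) (xi n (Suc z)) (count_space UNIV) (\<lambda>\<omega>. \<Sum>i\<in>{1..z}. xi n i \<omega>)"
proof -
  let ?A = "{(n, Suc z)}" and ?B = "{n} \<times> {1..z}"
  have "indep_var (count_space UNIV) ((\<lambda>w. w (n, Suc z)) \<circ> (\<lambda>\<omega>. restrict (\<lambda>p. \<Xi> p \<omega>) ?A))
     (count_space UNIV) ((\<lambda>w. \<Sum>i\<in>{1..z}. w (n, i)) \<circ> (\<lambda>\<omega>. restrict (\<lambda>p. \<Xi> p \<omega>) ?B))"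
    by (intro indep_var_compose [OF indep_var_restrict [OF indep]] measurable_sum_nat measurable_component_singleton) auto
  then show ?thesis by (simp add: comp_def)
qed

lemma nn_integral_sum_xi: "(\<integral>\<^sup>+\<omega>. f (\<Sum>i\<in>{1..z}. xi n i \<omega>) \<partial>M) = gw_step F f z"
proof (induction z arbitrary: f)
  case 0
  show ?case by (simp add: gw_step_def emeasure_space_1)
next
  case (Suc z)
  let ?S = "\<lambda>\<omega>. \<Sum>i\<in>{1..z}. xi n i \<omega>"
  have "(\<integral>\<^sup>+\<omega>. f (xi n (Suc z) \<omega> + ?S \<omega>) \<partial>M) = (\<integral>\<^sup>+\<omega>. \<integral>\<^sup>+\<omega>'. f (xi n (Suc z) \<omega> + ?S \<omega>') \<partial>M \<partial>M)"
    using indep_next_sum by (rule indep_var_nn_integral_nat)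
  also have "\<dots> = (\<integral>\<^sup>+k. gw_step F (\<lambda>s. f (k + s)) z \<partial>F)"
  proof -
    have "(\<integral>\<^sup>+\<omega>'. f (k + ?S \<omega>') \<partial>M) = gw_step F (\<lambda>s. f (k + s)) z" for k
      by (rule Suc)
    then show ?thesis using nn_integral_xi [of "\<lambda>k. gw_step F (\<lambda>s. f (k + s)) z" n "Suc z"] by simp
  qed
  also have "\<dots> = gw_step F f (Suc z)"
    unfolding gw_step_def nn_integral_replicate_pmf_Suc by simp
  finally show ?case by (simp add: add.commute)
qed

lemma indep_Z_sum:
  "indep_var (count_space UNIV) (GW_Z xi n) (count_space UNIV) (\<lambda>\<omega>. \<Sum>i\<in>{1..z}. xi n i \<omega>)"
proof -
  let ?A = "{..<n} \<times> UNIV" and ?B = "{n} \<times> {1..z}"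
  \<comment> \<open>The size of generation \<open>n\<close> as a function of coordinates from
    earlier generations only, whose index set is disjoint from \<open>?B\<close>.\<close>
  let ?Z = "GW_Z (\<lambda>k i w. w (k, i)) n"
  have "indep_var (count_space UNIV) (?Z \<circ> (\<lambda>\<omega>. restrict (\<lambda>p. \<Xi> p \<omega>) ?A))
     (count_space UNIV) ((\<lambda>w. \<Sum>i\<in>{1..z}. w (n, i)) \<circ> (\<lambda>\<omega>. restrict (\<lambda>p. \<Xi> p \<omega>) ?B))"
    by (intro indep_var_compose [OF indep_var_restrict [OF indep]] GW_Z_measurable measurable_sum_nat measurable_component_singleton) auto
  moreover have "?Z \<circ> (\<lambda>\<omega>. restrict (\<lambda>p. \<Xi> p \<omega>) ?A) = GW_Z xi n"
    by (rule ext) (simp only: o_apply, rule GW_Z_cong, simp)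
  ultimately show ?thesis by (simp add: comp_def)
qed

text \<open>Splitting by the value of \<open>GW_Z xi n\<close> makes the number of summands
  deterministic, and independence applies to each piece. The function sees both generations because
  the increments of \<open>W_n\<close> need it.\<close>

lemma nn_integral_Z_Suc:
  "(\<integral>\<^sup>+\<omega>. f (GW_Z xi n \<omega>) (GW_Z xi (Suc n) \<omega>) \<partial>M)
    = (\<integral>\<^sup>+\<omega>. gw_step F (f (GW_Z xi n \<omega>)) (GW_Z xi n \<omega>) \<partial>M)"
proof -
  let ?Z = "GW_Z xi n" and ?S = "\<lambda>z \<omega>. \<Sum>i\<in>{1..z}. xi n i \<omega>"
  have split: "g (?Z \<omega>) = (\<Sum>z. (if ?Z \<omega> = z then g z else 0))" for g :: "nat \<Rightarrow> ennreal" and \<omega>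
    using suminf_finite [of "{?Z \<omega>}" "\<lambda>z. if ?Z \<omega> = z then g z else 0"] by simp
  have "(\<integral>\<^sup>+\<omega>. f (?Z \<omega>) (GW_Z xi (Suc n) \<omega>) \<partial>M)
      = (\<integral>\<^sup>+\<omega>. (\<Sum>z. (if ?Z \<omega> = z then f z (?S z \<omega>) else 0)) \<partial>M)"
    by (intro nn_integral_cong, subst split [of "\<lambda>z. f z (?S z _)", symmetric]) simp
  also have "\<dots> = (\<Sum>z. \<integral>\<^sup>+\<omega>. (if ?Z \<omega> = z then f z (?S z \<omega>) else 0) \<partial>M)"
    by (intro nn_integral_suminf) measurable
  also have "\<dots> = (\<Sum>z. \<integral>\<^sup>+\<omega>. (if ?Z \<omega> = z then gw_step F (f z) z else 0) \<partial>M)"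
  proof (intro suminf_cong)
    fix z
    have "(\<integral>\<^sup>+\<omega>. (if ?Z \<omega> = z then f z (?S z \<omega>) else 0) \<partial>M)
       = (\<integral>\<^sup>+\<omega>. \<integral>\<^sup>+\<omega>'. (if ?Z \<omega> = z then f z (?S z \<omega>') else 0) \<partial>M \<partial>M)"
      by (rule indep_var_nn_integral_nat [OF indep_Z_sum, where h = "\<lambda>w s. if w = z then f z s else 0"])
    also have "\<dots> = (\<integral>\<^sup>+\<omega>. (if ?Z \<omega> = z then gw_step F (f z) z else 0) \<partial>M)"
      using nn_integral_sum_xi [of "f z" n z] by (intro nn_integral_cong) simp
    finally show "(\<integral>\<^sup>+\<omega>. (if ?Z \<omega> = z then f z (?S z \<omega>) else 0) \<partial>M)
       = (\<integral>\<^sup>+\<omega>. (if ?Z \<omega> = z then gw_step F (f z) z else 0) \<partial>M)" .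
  qed
  also have "\<dots> = (\<integral>\<^sup>+\<omega>. (\<Sum>z. (if ?Z \<omega> = z then gw_step F (f z) z else 0)) \<partial>M)"
    by (intro nn_integral_suminf [symmetric]) measurable
  also have "\<dots> = (\<integral>\<^sup>+\<omega>. gw_step F (f (?Z \<omega>)) (?Z \<omega>) \<partial>M)"
    by (simp only: split [of "\<lambda>z. gw_step F (f z) z", symmetric])
  finally show ?thesis .
qed

lemma nn_integral_Z: "(\<integral>\<^sup>+\<omega>. f (GW_Z xi n \<omega>) \<partial>M) = (gw_step F ^^ n) f 1"
proof (induction n arbitrary: f)
  case 0
  show ?case by (simp add: emeasure_space_1)
next
  case (Suc n)
  show ?case
    unfolding nn_integral_Z_Suc [where f = "\<lambda>_. f"] funpow_Suc_apply by (rule Suc)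
qed

end

section \<open>Almost sure convergence of the normalised process\<close>

locale gw_process_L2 = gw_process + gw_offspring
begin

lemma W_measurable [measurable]: "GW_W xi m n \<in> borel_measurable M"
  unfolding GW_W_def by measurable

lemma Wlim_measurable [measurable]: "GW_Wlim xi m \<in> borel_measurable M"
  unfolding GW_Wlim_def by measurable

lemma prob_W:
  "ennreal (prob {\<omega>\<in>space M. GW_W xi m n \<omega> > x}) = (gw_step F ^^ n) (indicator {z. m ^ n * x < real z}) 1"
proof -
  have "{\<omega>\<in>space M. GW_W xi m n \<omega> > x} = {\<omega>\<in>space M. m ^ n * x < real (GW_Z xi n \<omega>)}"
    using m_pos by (auto simp: GW_W_def pos_less_divide_eq mult.commute)
  then have "ennreal (prob {\<omega>\<in>space M. GW_W xi m n \<omega> > x})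
      = (\<integral>\<^sup>+\<omega>. indicator {\<omega>\<in>space M. m ^ n * x < real (GW_Z xi n \<omega>)} \<omega> \<partial>M)"
    by (simp add: emeasure_eq_measure)
  also have "\<dots> = (\<integral>\<^sup>+\<omega>. indicator {z. m ^ n * x < real z} (GW_Z xi n \<omega>) \<partial>M)"
    by (intro nn_integral_cong) (auto simp: indicator_def)
  finally show ?thesis by (simp add: nn_integral_Z)
qed

text \<open>The unnormalised increment \<open>u\<close> has second moment of order
  \<open>m ^ n\<close>, so \<open>R = sqrt m ^ n\<close> balances the two terms of
  \<open>\<bar>u\<bar> \<le> u\<^sup>2 / R + R\<close>; division by \<open>m ^ Suc n\<close> leaves
  order \<open>1 / R\<close>.\<close>

lemma nn_integral_W_increment_le:
  "(\<integral>\<^sup>+\<omega>. ennreal \<bar>GW_W xi m (Suc n) \<omega> - GW_W xi m n \<omega>\<bar> \<partial>M) \<le> ennreal ((s2 - m\<^sup>2 + 1) / m * (1 / sqrt m) ^ n)"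
proof -
  define R where "R = sqrt m ^ n"
  have R: "R > 0" "m ^ n = R * R"
    using m_pos by (auto simp: R_def power_mult_distrib [symmetric])
  define v where "v = s2 - m\<^sup>2"
  have v: "0 \<le> v" using variance_nonneg by (simp add: v_def)
  define A where "A = 1 / R / m ^ Suc n"
  define B where "B = R / m ^ Suc n"
  have A: "0 \<le> A" and B: "0 \<le> B" using R m_pos by (auto simp: A_def B_def)
  let ?f = "\<lambda>z z'. ennreal A * ennreal ((real z' - real z * m)\<^sup>2) + ennreal B * 1"
  have "(\<integral>\<^sup>+\<omega>. ennreal \<bar>GW_W xi m (Suc n) \<omega> - GW_W xi m n \<omega>\<bar> \<partial>M)
     \<le> (\<integral>\<^sup>+\<omega>. ?f (GW_Z xi n \<omega>) (GW_Z xi (Suc n) \<omega>) \<partial>M)"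
  proof (intro nn_integral_mono)
    fix \<omega>
    define u where "u = real (GW_Z xi (Suc n) \<omega>) - real (GW_Z xi n \<omega>) * m"
    have "GW_W xi m (Suc n) \<omega> - GW_W xi m n \<omega> = u / m ^ Suc n"
      using m_pos by (simp add: GW_W_def u_def diff_divide_distrib del: GW_Z.simps)
    then have "\<bar>GW_W xi m (Suc n) \<omega> - GW_W xi m n \<omega>\<bar> = \<bar>u\<bar> / m ^ Suc n"
      using m_pos by simp
    also have "\<dots> \<le> (1 / R * u\<^sup>2 + R) / m ^ Suc n"
      using le_square_trade_off [of 1 R "\<bar>u\<bar>"] R(1) m_pos by (intro divide_right_mono) auto
    also have "\<dots> = A * u\<^sup>2 + B"
      by (simp add: add_divide_distrib A_def B_def)
    finally have "ennreal \<bar>GW_W xi m (Suc n) \<omega> - GW_W xi m n \<omega>\<bar> \<le> ennreal (A * u\<^sup>2 + B)" by (rule ennreal_leI)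
    also have "\<dots> = ennreal A * ennreal (u\<^sup>2) + ennreal B * 1"
      using A B by (simp add: ennreal_mult')
    finally show "ennreal \<bar>GW_W xi m (Suc n) \<omega> - GW_W xi m n \<omega>\<bar> \<le> ?f (GW_Z xi n \<omega>) (GW_Z xi (Suc n) \<omega>)"
      unfolding u_def .
  qed
  also have "\<dots> = (\<integral>\<^sup>+\<omega>. gw_step F (?f (GW_Z xi n \<omega>)) (GW_Z xi n \<omega>) \<partial>M)"
    by (rule nn_integral_Z_Suc)
  also have "\<dots> = (\<integral>\<^sup>+\<omega>. ennreal (A * v) * ennreal (real (GW_Z xi n \<omega>)) + ennreal B \<partial>M)"
  proof (intro nn_integral_cong)
    fix \<omega>
    let ?z = "GW_Z xi n \<omega>"
    have "gw_step F (?f ?z) ?z = ennreal A * ennreal (real ?z * v) + ennreal B"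
      unfolding gw_step_linear gw_step_square gw_step_one v_def by simp
    also have "ennreal A * ennreal (real ?z * v) = ennreal (A * v) * ennreal (real ?z)"
      using A v by (simp add: ennreal_mult mult_ac)
    finally show "gw_step F (?f ?z) ?z = ennreal (A * v) * ennreal (real ?z) + ennreal B" .
  qed
  also have "\<dots> = ennreal (A * v) * (\<integral>\<^sup>+\<omega>. ennreal (real (GW_Z xi n \<omega>)) \<partial>M) + ennreal B"
    by (simp add: nn_integral_add nn_integral_cmult emeasure_space_1)
  also have "(\<integral>\<^sup>+\<omega>. ennreal (real (GW_Z xi n \<omega>)) \<partial>M) = ennreal (m ^ n)"
    using nn_integral_Z [of "\<lambda>z. ennreal (real z)" n] gw_iter_real [of n 1] by simp
  also have "ennreal (A * v) * ennreal (m ^ n) + ennreal B = ennreal (A * v * m ^ n + B)"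
    using A B v m_pos by (simp add: ennreal_mult)
  also have "A * v * m ^ n + B = (v + 1) / m * (1 / sqrt m) ^ n"
  proof -
    have "(1 / sqrt m) ^ n = 1 / R" by (simp add: R_def power_one_over)
    then show ?thesis
      unfolding A_def B_def power_Suc R(2) using R(1) m_pos by (simp add: field_simps)
  qed
  finally show ?thesis by (simp add: v_def)
qed

text \<open>\<open>GW_Wlim\<close> is defined by \<open>lim\<close>, which is meaningful only where
  the sequence converges. Summable norms make the increments absolutely summable almost surely,
  hence the telescoping sums converge.\<close>

lemma W_tendsto: "AE \<omega> in M. (\<lambda>n. GW_W xi m n \<omega>) \<longlonglongrightarrow> GW_Wlim xi m \<omega>"
proof -
  let ?D = "\<lambda>n \<omega>. GW_W xi m (Suc n) \<omega> - GW_W xi m n \<omega>"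
  let ?q = "1 / sqrt m" and ?C = "(s2 - m\<^sup>2 + 1) / m"
  have q: "0 \<le> ?q" "?q < 1" using mean_gt by auto
  have C: "0 \<le> ?C" using variance_nonneg m_pos by (intro divide_nonneg_pos) auto
  have summ: "summable (\<lambda>n. ?C * ?q ^ n)"
    using q by (intro summable_mult summable_geometric) auto
  have "(\<integral>\<^sup>+\<omega>. (\<Sum>n. ennreal \<bar>?D n \<omega>\<bar>) \<partial>M) = (\<Sum>n. \<integral>\<^sup>+\<omega>. ennreal \<bar>?D n \<omega>\<bar> \<partial>M)"
    by (intro nn_integral_suminf) measurable
  also have "\<dots> \<le> (\<Sum>n. ennreal (?C * ?q ^ n))"
    by (intro suminf_le nn_integral_W_increment_le summableI)
  also have "\<dots> = ennreal (\<Sum>n. ?C * ?q ^ n)"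
    by (intro suminf_ennreal2 summ mult_nonneg_nonneg C zero_le_power q)
  finally have le: "(\<integral>\<^sup>+\<omega>. (\<Sum>n. ennreal \<bar>?D n \<omega>\<bar>) \<partial>M) \<le> ennreal (\<Sum>n. ?C * ?q ^ n)" .
  have "(\<integral>\<^sup>+\<omega>. (\<Sum>n. ennreal \<bar>?D n \<omega>\<bar>) \<partial>M) \<noteq> \<infinity>"
    using order.strict_trans1 [OF le ennreal_less_top] by (simp only: infinity_ennreal_def less_top)
  then have "AE \<omega> in M. (\<Sum>n. ennreal \<bar>?D n \<omega>\<bar>) \<noteq> \<infinity>"
    by (intro nn_integral_PInf_AE) measurable
  then show ?thesis
  proof eventually_elim
    case (elim \<omega>)
    have "summable (\<lambda>n. \<bar>?D n \<omega>\<bar>)"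
      using elim by (intro summable_suminf_not_top) auto
    then have "summable (\<lambda>n. ?D n \<omega>)" by (rule summable_rabs_cancel)
    then have "(\<lambda>n. (\<Sum>k<n. ?D k \<omega>) + GW_W xi m 0 \<omega>) \<longlonglongrightarrow> suminf (\<lambda>n. ?D n \<omega>) + GW_W xi m 0 \<omega>"
      by (intro tendsto_add tendsto_const summable_LIMSEQ)
    moreover have "(\<Sum>k<n. ?D k \<omega>) + GW_W xi m 0 \<omega> = GW_W xi m n \<omega>" for n
      using sum_lessThan_telescope [of "\<lambda>n. GW_W xi m n \<omega>" n] by simp
    ultimately have "convergent (\<lambda>n. GW_W xi m n \<omega>)"
      unfolding convergent_def by auto
    then show ?case unfolding GW_Wlim_def by (simp add: convergent_LIMSEQ_iff)
  qed
qed

lemma prob_Wlim_le: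
  assumes "\<forall>\<^sub>F n in sequentially. prob {\<omega>\<in>space M. GW_W xi m n \<omega> > x} \<le> u"
  shows "prob {\<omega>\<in>space M. GW_Wlim xi m \<omega> > x} \<le> u"
  using prob_open_le_of_AE_tendsto [OF _ _ W_tendsto, of "{x<..}" u] assms by simp

text \<open>The bound for open sets is applied to the lower half-line \<open>{..<x'}\<close>, which
  contains the complement of the event in question; this is why a gap between \<open>x\<close> and
  \<open>x'\<close> is required.\<close>

lemma prob_Wlim_ge:
  assumes "x < x'" and ge: "\<forall>\<^sub>F n in sequentially. u \<le> prob {\<omega>\<in>space M. GW_W xi m n \<omega> > x'}"
  shows "u \<le> prob {\<omega>\<in>space M. GW_Wlim xi m \<omega> > x}"
proof -
  have compl: "prob {\<omega>\<in>space M. \<not> X \<omega> > a} = 1 - prob {\<omega>\<in>space M. X \<omega> > a}"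
    if [measurable]: "X \<in> borel_measurable M" for X :: "'a \<Rightarrow> real" and a
    using prob_neg [of "\<lambda>\<omega>. X \<omega> > a"] by simp
  have "prob {\<omega>\<in>space M. GW_Wlim xi m \<omega> \<in> {..<x'}} \<le> 1 - u"
  proof (rule prob_open_le_of_AE_tendsto [OF _ _ W_tendsto])
    show "\<forall>\<^sub>F n in sequentially. prob {\<omega>\<in>space M. GW_W xi m n \<omega> \<in> {..<x'}} \<le> 1 - u"
      using ge
    proof eventually_elim
      case (elim n)
      have "prob {\<omega>\<in>space M. GW_W xi m n \<omega> \<in> {..<x'}} \<le> prob {\<omega>\<in>space M. \<not> GW_W xi m n \<omega> > x'}"
        by (intro finite_measure_mono) auto
      then show ?case using elim by (simp only: compl [OF W_measurable])
    qed
  qed auto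
  moreover have "prob {\<omega>\<in>space M. \<not> GW_Wlim xi m \<omega> > x} \<le> prob {\<omega>\<in>space M. GW_Wlim xi m \<omega> \<in> {..<x'}}"
    using assms(1) by (intro finite_measure_mono) auto
  ultimately show ?thesis using compl [OF Wlim_measurable, of x] by linarith
qed

end

locale heavy_process = gw_process_L2 + heavy_offspring
begin

lemma prob_W_uniform:
  assumes "\<epsilon> > 0"
  shows "\<exists>x0. \<forall>x\<ge>x0. \<forall>n\<ge>1. \<bar>prob {\<omega>\<in>space M. GW_W xi m n \<omega> > x} - S n x\<bar> \<le> \<epsilon> * S n x"
proof -
  obtain x0 where x0: "\<And>x n p. x \<ge> x0 \<Longrightarrow> n \<ge> 1 \<Longrightarrow> p \<ge> 0 \<Longrightarrow>
      ennreal p = (gw_step F ^^ n) (indicator {z. m ^ n * x < real z}) 1 \<Longrightarrow> \<bar>p - S n x\<bar> \<le> \<epsilon> * S n x"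
    using gw_asymp [OF assms] unfolding eventually_at_top_linorder by blast
  have "\<bar>prob {\<omega>\<in>space M. GW_W xi m n \<omega> > x} - S n x\<bar> \<le> \<epsilon> * S n x" if "x \<ge> x0" "n \<ge> 1" for x n
    using that by (intro x0 prob_W) auto
  then show ?thesis by blast
qed

lemma prob_W_joint:
  assumes "\<epsilon> > 0"
  shows "\<exists>x0 N. \<forall>x\<ge>x0. \<forall>n\<ge>N. \<bar>prob {\<omega>\<in>space M. GW_W xi m n \<omega> > x} - S_inf x\<bar> \<le> \<epsilon> * S_inf x"
proof -
  have e: "\<epsilon> / 2 > 0" using assms by simp
  obtain x0 where x0: "\<And>x n. x \<ge> x0 \<Longrightarrow> n \<ge> 1 \<Longrightarrow>
      \<bar>prob {\<omega>\<in>space M. GW_W xi m n \<omega> > x} - S n x\<bar> \<le> \<epsilon> / 2 * S n x"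
    using prob_W_uniform [OF e] by blast
  obtain N where N: "\<And>x n. x \<ge> 1 \<Longrightarrow> n \<ge> N \<Longrightarrow> S_inf x - S n x \<le> \<epsilon> / 2 * S_inf x"
    using S_inf_minus_S_le [OF e] by blast
  have "\<bar>prob {\<omega>\<in>space M. GW_W xi m n \<omega> > x} - S_inf x\<bar> \<le> \<epsilon> * S_inf x"
    if "x \<ge> max x0 1" "n \<ge> max N 1" for x n
  proof -
    have "\<epsilon> / 2 * S n x \<le> \<epsilon> / 2 * S_inf x"
      using S_le_S_inf [of x n] that assms by (intro mult_left_mono) auto
    moreover have "\<bar>prob {\<omega>\<in>space M. GW_W xi m n \<omega> > x} - S n x\<bar> \<le> \<epsilon> / 2 * S n x"
      using that by (intro x0) auto
    moreover have "S_inf x - S n x \<le> \<epsilon> / 2 * S_inf x"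
      using that by (intro N) auto
    moreover have "S n x \<le> S_inf x"
      using that by (intro S_le_S_inf) auto
    ultimately show ?thesis unfolding abs_le_iff by linarith
  qed
  then show ?thesis by blast
qed

lemma prob_Wlim_asymp:
  "(\<lambda>x. prob {\<omega>\<in>space M. GW_Wlim xi m \<omega> > x}) \<sim>[at_top] S_inf"
proof (rule asymp_equivI', rule tendstoI)
  fix \<epsilon> :: real assume "\<epsilon> > 0"
  define e where "e = min \<epsilon> 1 / 2"
  have e: "0 < e" "e < 1" "e < \<epsilon>" using \<open>\<epsilon> > 0\<close> by (auto simp: e_def)
  obtain x0 N where b: "\<And>x n. x \<ge> x0 \<Longrightarrow> n \<ge> N \<Longrightarrow>
      \<bar>prob {\<omega>\<in>space M. GW_W xi m n \<omega> > x} - S_inf x\<bar> \<le> e * S_inf x"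
    using prob_W_joint [OF e(1)] by blast
  show "\<forall>\<^sub>F x in at_top. dist (prob {\<omega>\<in>space M. GW_Wlim xi m \<omega> > x} / S_inf x) 1 < \<epsilon>"
    using eventually_ge_at_top [of "max x0 1"]
  proof eventually_elim
    case (elim x)
    let ?P = "prob {\<omega>\<in>space M. GW_Wlim xi m \<omega> > x}"
    have x: "x \<ge> x0" "x \<ge> 1" using elim by auto
    have "?P \<le> (1 + e) * S_inf x"
    proof (rule prob_Wlim_le)
      show "\<forall>\<^sub>F n in sequentially. prob {\<omega>\<in>space M. GW_W xi m n \<omega> > x} \<le> (1 + e) * S_inf x"
        using eventually_ge_at_top [of N]
        by eventually_elim (use b [OF x(1)] in \<open>simp add: abs_le_iff algebra_simps\<close>)
    qed
    moreover have "(1 - e) * S_inf x \<le> ?P"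
    \<comment> \<open>The lower bound is available for each \<open>x' > x\<close> and is carried
      down to \<open>x\<close> itself; \<open>e < 1\<close> supplies the nonnegative factor.\<close>
    proof (rule S_inf_right_limit [OF x(2)])
      fix x' assume x': "x' > x"
      then have "x' \<ge> x0" using x by simp
      then have "\<forall>\<^sub>F n in sequentially. (1 - e) * S_inf x' \<le> prob {\<omega>\<in>space M. GW_W xi m n \<omega> > x'}"
        using eventually_ge_at_top [of N]
        by (intro eventually_mono [OF eventually_ge_at_top [of N]])
          (use b [of x'] in \<open>simp add: abs_le_iff algebra_simps\<close>)
      then show "(1 - e) * S_inf x' \<le> ?P" by (rule prob_Wlim_ge [OF x'])
    qed (use e in simp)
    ultimately have "\<bar>?P - S_inf x\<bar> \<le> e * S_inf x" by (simp add: abs_le_iff algebra_simps)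
    then have "\<bar>?P / S_inf x - 1\<bar> \<le> e"
      using S_inf_pos [OF x(2)] by (simp add: abs_le_iff field_simps)
    then show ?case using e by (simp add: dist_real_def)
  qed
qed

end

theorem theorem2:
  fixes M :: "'a measure" and xi :: "nat \<Rightarrow> nat \<Rightarrow> 'a \<Rightarrow> nat"
    and F :: "nat pmf" and \<delta> c \<gamma> :: real
  assumes "prob_space M"
    and indep: "prob_space.indep_vars M (\<lambda>_. count_space UNIV) (\<lambda>(n, i). xi n i) UNIV"
    and distr: "\<And>n i. distr M (count_space UNIV) (xi n i) = measure_pmf F"
    and mean_gt: "pmf_mean F > 1"
    and dom_var: "\<exists>C. \<forall>x::real. tail F (x / 2) \<le> C * tail F x"
    and delta_pos: "\<delta> > 0"
    and bound: "\<And>x y. x > 1 \<Longrightarrow> y > 1 \<Longrightarrow> tail F (x * y) \<le> c * tail F x / y powr (1 + \<delta>)"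
    and second_moment: "integrable (measure_pmf F) (\<lambda>k. real k ^ 2)"
    and gamma: "\<gamma> > 1/2"
    and insens: "(\<lambda>x. tail F (x + x powr \<gamma>)) \<sim>[at_top] tail F"
  shows
    "(\<forall>\<epsilon>>0. \<exists>x0. \<forall>x\<ge>x0. \<forall>n\<ge>1.
        \<bar>prob_space.prob M {\<omega>\<in>space M. GW_W xi (pmf_mean F) n \<omega> > x}
          - (\<Sum>i<n. pmf_mean F ^ i * tail F (pmf_mean F ^ (i+1) * x))\<bar>
        \<le> \<epsilon> * (\<Sum>i<n. pmf_mean F ^ i * tail F (pmf_mean F ^ (i+1) * x)))
   \<and> (\<forall>\<epsilon>>0. \<exists>x0 N. \<forall>x\<ge>x0. \<forall>n\<ge>N.
        \<bar>prob_space.prob M {\<omega>\<in>space M. GW_W xi (pmf_mean F) n \<omega> > x}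
          - (\<Sum>i. pmf_mean F ^ i * tail F (pmf_mean F ^ (i+1) * x))\<bar>
        \<le> \<epsilon> * (\<Sum>i. pmf_mean F ^ i * tail F (pmf_mean F ^ (i+1) * x)))
   \<and> (\<lambda>x. prob_space.prob M {\<omega>\<in>space M. GW_Wlim xi (pmf_mean F) \<omega> > x})
        \<sim>[at_top] (\<lambda>x. \<Sum>i. pmf_mean F ^ i * tail F (pmf_mean F ^ (i+1) * x))"
proof -
  interpret prob_space M by fact
  interpret heavy_process M xi F \<delta> c \<gamma>
    by unfold_locales (fact indep distr mean_gt second_moment dom_var delta_pos gamma insens | rule bound; assumption)+
  have S: "S n x = (\<Sum>i<n. pmf_mean F ^ i * tail F (pmf_mean F ^ (i+1) * x))" for n x
    by (simp add: S_def)
  have S_inf: "S_inf = (\<lambda>x. \<Sum>i. pmf_mean F ^ i * tail F (pmf_mean F ^ (i+1) * x))"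
    by (simp add: S_inf_def fun_eq_iff)
  show ?thesis
    using prob_W_uniform prob_W_joint prob_Wlim_asymp unfolding S S_inf by blast
qed

end
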